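(* Let $\Phi$ be a $C^1$ flow on a connected compact $C^1$ manifold $X$. Assume that $(X,\Phi)$ can be linearized by a $C^1$ embedding and that $\Phi$ has at least one isolated equilibrium. Then $X$ is even-dimensional, and the Hopf index of the vector field generating $\Phi$ at any isolated equilibrium is equal to $1$.
   Context: Manifolds are, as usual, finite-dimensional, Hausdorff, second countable and without boundary. A flow on $X$ is a group action $\Phi\colon \mathbb{R}\times X\to X$, $(t,x)\mapsto \Phi^t(x)$, of $(\mathbb{R},+)$ on $X$; it is $C^1$ if $\Phi$ is a $C^1$ map. The vector field generating $\Phi$ is the (continuous) vector field $x\mapsto\frac{d}{dt}\Phi^t(x)|_{t=0}$. An equilibrium is a point fixed by all $\Phi^t$ (a zero of the generating vector field), and it is isolated if it is an isolated point of the set of equilibria. The Hopf index is the usual Poincaré–Hopf index of an isolated zero of a vector field. A map $F\colon X\to\mathbb{R}^n$ is linearizing (for $\Phi$) if there is a matrix $B\in\mathbb{R}^{n\times n}$ such that $F\circ\Phi^t=e^{Bt}\circ F$ for all $t\in\mathbb{R}$. A $C^1$ embedding is a $C^1$ map that is both an immersion and a homeomorphism onto its image. $(X,\Phi)$ can be linearized by a $C^1$ embedding if for some $n\in\mathbb{N}$ there is a linearizing $C^1$ embedding $F\colon X\to\mathbb{R}^n$. *)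

theory Defs
  imports
    "HOL-Analysis.Analysis"
    "HOL-Homology.Homology"
    "Jordan_Normal_Form.Matrix"
begin

section \<open>C1 maps between open subsets of Euclidean spaces\<close>

text \<open>
  The space \<open>\<real>\<^sup>n\<close> is the library's \<^const>\<open>Euclidean_space\<close> \<open>n\<close>: its points are the
  \<open>x :: nat \<Rightarrow> real\<close> with \<open>x i = 0\<close> for \<open>i \<ge> n\<close>. The dimension is thus a number, may be zero,
  and can be quantified inside formulas.
\<close>

definition partial_deriv :: "nat \<Rightarrow> ((nat \<Rightarrow> real) \<Rightarrow> real) \<Rightarrow> (nat \<Rightarrow> real) \<Rightarrow> real" where
  "partial_deriv i f x = deriv (\<lambda>s. f (x(i := s))) (x i)"

text \<open>Only meaningful when \<open>W\<close> is open in \<^term>\<open>Euclidean_space m\<close>.\<close>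

definition C1_on ::
  "nat \<Rightarrow> nat \<Rightarrow> (nat \<Rightarrow> real) set \<Rightarrow> ((nat \<Rightarrow> real) \<Rightarrow> nat \<Rightarrow> real) \<Rightarrow> bool" where
  "C1_on m n W f \<longleftrightarrow>
     f ` W \<subseteq> topspace (Euclidean_space n) \<and>
     (\<forall>i<m. \<forall>j<n.
        (\<forall>x\<in>W. (\<lambda>s. f (x(i := s)) j) field_differentiable (at (x i))) \<and>
        continuous_map (subtopology (Euclidean_space m) W) euclideanreal
          (partial_deriv i (\<lambda>x. f x j)))"

text \<open>The Jacobian of \<open>f\<close> at \<open>x\<close>, applied to \<open>v\<close>.\<close>

definition differential ::
  "nat \<Rightarrow> ((nat \<Rightarrow> real) \<Rightarrow> nat \<Rightarrow> real) \<Rightarrow> (nat \<Rightarrow> real) \<Rightarrow> (nat \<Rightarrow> real) \<Rightarrow> nat \<Rightarrow> real" where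
  "differential m f x v = (\<lambda>j. \<Sum>i<m. partial_deriv i (\<lambda>y. f y j) x * v i)"


section \<open>C1 manifolds\<close>

text \<open>A chart is a pair \<open>(U, \<phi>)\<close>; the values of \<open>\<phi>\<close> outside \<open>U\<close> are irrelevant.\<close>

type_synonym 'a chart = "'a set \<times> ('a \<Rightarrow> nat \<Rightarrow> real)"

definition chart_on :: "nat \<Rightarrow> 'a topology \<Rightarrow> 'a chart \<Rightarrow> bool" where
  "chart_on d X = (\<lambda>(U, \<phi>).
     openin X U \<and> openin (Euclidean_space d) (\<phi> ` U) \<and>
     homeomorphic_map (subtopology X U) (subtopology (Euclidean_space d) (\<phi> ` U)) \<phi>)"

text \<open>
  The atlas need not be maximal. Both orders of a pair of charts are quantified over, so
  the coordinate changes are C1 diffeomorphisms.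
\<close>

definition C1_atlas :: "nat \<Rightarrow> 'a topology \<Rightarrow> 'a chart set \<Rightarrow> bool" where
  "C1_atlas d X A \<longleftrightarrow>
     (\<forall>c\<in>A. chart_on d X c) \<and>
     (\<Union>(U, \<phi>)\<in>A. U) = topspace X \<and>
     (\<forall>(U, \<phi>)\<in>A. \<forall>(V, \<psi>)\<in>A. C1_on d d (\<phi> ` (U \<inter> V)) (\<psi> \<circ> inv_into U \<phi>))"

definition C1_manifold :: "nat \<Rightarrow> 'a topology \<Rightarrow> 'a chart set \<Rightarrow> bool" where
  "C1_manifold d X A \<longleftrightarrow> Hausdorff_space X \<and> second_countable X \<and> C1_atlas d X A"

definition C1_map ::
  "nat \<Rightarrow> 'a topology \<Rightarrow> 'a chart set \<Rightarrow> nat \<Rightarrow> 'b topology \<Rightarrow> 'b chart set \<Rightarrow> ('a \<Rightarrow> 'b) \<Rightarrow> bool"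
  where
  "C1_map m X A n Y A' f \<longleftrightarrow>
     continuous_map X Y f \<and>
     (\<forall>(U, \<phi>)\<in>A. \<forall>(V, \<psi>)\<in>A'. C1_on m n (\<phi> ` (U \<inter> f -` V)) (\<psi> \<circ> f \<circ> inv_into U \<phi>))"

definition immersion ::
  "nat \<Rightarrow> 'a chart set \<Rightarrow> nat \<Rightarrow> 'b chart set \<Rightarrow> ('a \<Rightarrow> 'b) \<Rightarrow> bool" where
  "immersion m A n A' f \<longleftrightarrow>
     (\<forall>(U, \<phi>)\<in>A. \<forall>(V, \<psi>)\<in>A'. \<forall>x \<in> U \<inter> f -` V. \<forall>v \<in> topspace (Euclidean_space m).
        (\<forall>j<n. differential m (\<psi> \<circ> f \<circ> inv_into U \<phi>) (\<phi> x) v j = 0) \<longrightarrow> v = (\<lambda>_. 0))"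

definition C1_embedding ::
  "nat \<Rightarrow> 'a topology \<Rightarrow> 'a chart set \<Rightarrow> nat \<Rightarrow> 'b topology \<Rightarrow> 'b chart set \<Rightarrow> ('a \<Rightarrow> 'b) \<Rightarrow> bool"
  where
  "C1_embedding m X A n Y A' f \<longleftrightarrow>
     C1_map m X A n Y A' f \<and> immersion m A n A' f \<and> embedding_map X Y f"

text \<open>The standard atlas of \<open>\<real>\<^sup>n\<close>, and the product atlas on \<open>\<real> \<times> X\<close> (the real factor becomes
  coordinate \<open>0\<close>).\<close>

definition Euclidean_atlas :: "nat \<Rightarrow> (nat \<Rightarrow> real) chart set" where
  "Euclidean_atlas n = {(topspace (Euclidean_space n), \<lambda>x. x)}"

definition real_times_atlas :: "'a chart set \<Rightarrow> (real \<times> 'a) chart set" where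
  "real_times_atlas A = (\<lambda>(U, \<phi>). (UNIV \<times> U, \<lambda>(t, x). case_nat t (\<phi> x))) ` A"


section \<open>Flows\<close>

definition flow :: "'a topology \<Rightarrow> (real \<Rightarrow> 'a \<Rightarrow> 'a) \<Rightarrow> bool" where
  "flow X \<Phi> \<longleftrightarrow>
     (\<forall>t. \<forall>x \<in> topspace X. \<Phi> t x \<in> topspace X) \<and>
     (\<forall>x \<in> topspace X. \<Phi> 0 x = x) \<and>
     (\<forall>s t. \<forall>x \<in> topspace X. \<Phi> (s + t) x = \<Phi> s (\<Phi> t x))"

definition C1_flow ::
  "nat \<Rightarrow> 'a topology \<Rightarrow> 'a chart set \<Rightarrow> (real \<Rightarrow> 'a \<Rightarrow> 'a) \<Rightarrow> bool" where
  "C1_flow d X A \<Phi> \<longleftrightarrow>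
     flow X \<Phi> \<and>
     C1_map (Suc d) (prod_topology euclideanreal X) (real_times_atlas A) d X A (\<lambda>(t, x). \<Phi> t x)"

definition equilibria :: "'a topology \<Rightarrow> (real \<Rightarrow> 'a \<Rightarrow> 'a) \<Rightarrow> 'a set" where
  "equilibria X \<Phi> = {x \<in> topspace X. \<forall>t. \<Phi> t x = x}"

definition isolated_equilibrium :: "'a topology \<Rightarrow> (real \<Rightarrow> 'a \<Rightarrow> 'a) \<Rightarrow> 'a \<Rightarrow> bool" where
  "isolated_equilibrium X \<Phi> p \<longleftrightarrow>
     p \<in> equilibria X \<Phi> \<and> p \<notin> X derived_set_of (equilibria X \<Phi>)"

text \<open>
  A vector field \<open>V\<close> is given by its components: \<open>V (U, \<phi>) x\<close> is the coordinate vector, in the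
  chart \<open>(U, \<phi>)\<close>, of the tangent vector at \<open>x \<in> U\<close>. For the generating vector field
  this is the time derivative at \<open>0\<close> of \<open>\<phi> (\<Phi> t x)\<close>, so components in different charts are
  related by the Jacobians of the coordinate changes.
\<close>

type_synonym 'a vfield = "'a chart \<Rightarrow> 'a \<Rightarrow> nat \<Rightarrow> real"

definition generating_vfield :: "(real \<Rightarrow> 'a \<Rightarrow> 'a) \<Rightarrow> 'a vfield" where
  "generating_vfield \<Phi> = (\<lambda>(U, \<phi>) x i. deriv (\<lambda>t. \<phi> (\<Phi> t x) i) 0)"


section \<open>The Poincare--Hopf index\<close>

definition enorm :: "nat \<Rightarrow> (nat \<Rightarrow> real) \<Rightarrow> real" where
  "enorm n x = sqrt (\<Sum>i<n. (x i)\<^sup>2)"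

definition closed_ball :: "nat \<Rightarrow> (nat \<Rightarrow> real) \<Rightarrow> real \<Rightarrow> (nat \<Rightarrow> real) set" where
  "closed_ball n c r = {y \<in> topspace (Euclidean_space n). enorm n (\<lambda>i. y i - c i) \<le> r}"

text \<open>
  The degree of the self-map \<open>u \<mapsto> w (c + r u) / \<bar>w (c + r u)\<bar>\<close> of the unit sphere of \<open>\<real>\<^sup>d\<close>, which
  is \<^term>\<open>nsphere (d - 1)\<close>. In dimension \<open>0\<close> that sphere is empty and the index is \<open>1\<close> by
  convention.
\<close>

definition sphere_degree ::
  "nat \<Rightarrow> ((nat \<Rightarrow> real) \<Rightarrow> nat \<Rightarrow> real) \<Rightarrow> (nat \<Rightarrow> real) \<Rightarrow> real \<Rightarrow> int" where
  "sphere_degree d w c r =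
     (if d = 0 then 1
      else Brouwer_degree2 (d - 1)
             (\<lambda>u. let y = w (\<lambda>i. c i + r * u i) in (\<lambda>i. y i / enorm d y)))"

text \<open>
  The index of an isolated zero \<open>p\<close> of \<open>V\<close> is the degree on any sphere around \<open>p\<close>, in any chart,
  such that \<open>p\<close> is the only zero in the closed ball. For continuous \<open>V\<close> the degree is the same
  for all these choices, hence the definite description.
\<close>

definition hopf_index :: "nat \<Rightarrow> 'a chart set \<Rightarrow> 'a vfield \<Rightarrow> 'a \<Rightarrow> int" where
  "hopf_index d A V p =
     (THE k. \<exists>(U, \<phi>)\<in>A. \<exists>r>0.
        p \<in> U \<and> closed_ball d (\<phi> p) r \<subseteq> \<phi> ` U \<and>
        (\<forall>x\<in>U. x \<noteq> p \<and> \<phi> x \<in> closed_ball d (\<phi> p) r \<longrightarrow> (\<exists>i<d. V (U, \<phi>) x i \<noteq> 0)) \<and>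
        k = sphere_degree d (\<lambda>y. V (U, \<phi>) (inv_into U \<phi> y)) (\<phi> p) r)"


section \<open>Linearization\<close>

definition mat_exp :: "real mat \<Rightarrow> real mat" where
  "mat_exp M =
     Matrix.mat (dim_row M) (dim_col M) (\<lambda>(i, j). suminf (\<lambda>k. (M ^\<^sub>m k) $$ (i, j) / fact k))"

definition linearizing ::
  "'a topology \<Rightarrow> (real \<Rightarrow> 'a \<Rightarrow> 'a) \<Rightarrow> nat \<Rightarrow> ('a \<Rightarrow> nat \<Rightarrow> real) \<Rightarrow> bool" where
  "linearizing X \<Phi> n F \<longleftrightarrow>
     F ` topspace X \<subseteq> topspace (Euclidean_space n) \<and>
     (\<exists>B \<in> carrier_mat n n. \<forall>t. \<forall>x \<in> topspace X.
        Matrix.vec n (F (\<Phi> t x)) = mat_exp (t \<cdot>\<^sub>m B) *\<^sub>v Matrix.vec n (F x))"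

definition linearizable_by_C1_embedding ::
  "nat \<Rightarrow> 'a topology \<Rightarrow> 'a chart set \<Rightarrow> (real \<Rightarrow> 'a \<Rightarrow> 'a) \<Rightarrow> bool" where
  "linearizable_by_C1_embedding d X A \<Phi> \<longleftrightarrow>
     (\<exists>n F. C1_embedding d X A n (Euclidean_space n) (Euclidean_atlas n) F \<and>
            linearizing X \<Phi> n F)"

end

theory Submission
  imports Defs "HOL-Real_Asymp.Real_Asymp"
begin

text \<open>
  Let \<open>p\<close> be an equilibrium and \<open>h = F - F p\<close>. The flow acts on the values of \<open>h\<close> by linear maps
  \<open>T\<^sub>t\<close>, and these values are bounded because \<open>X\<close> is compact. Since they span a finite-dimensional
  space, there is a constant \<open>C\<close> such that \<open>T\<^sub>t z\<close> has norm at most \<open>C\<close> times that of \<open>z\<close>, for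
  all times \<open>t\<close>, positive or negative, and all \<open>z\<close> in the span (\<open>orbits_uniformly_bounded\<close>).

  Consider the generating field \<open>w\<close> in a chart around \<open>p\<close>, with \<open>c\<close> the position of \<open>p\<close>. Near \<open>c\<close>
  the field is never a nonzero multiple of the radial field \<open>y - c\<close> (\<open>vfield_not_radial\<close>). Indeed,
  suppose that \<open>w y = a (y - c)\<close> with \<open>a \<noteq> 0\<close> and let \<open>z\<close> be the value of \<open>h\<close> at \<open>y\<close>. The orbit
  of \<open>z\<close> starts with velocity \<open>Dh(y) w y = a Dh(y) (y - c) = a (z + e)\<close>, where \<open>e\<close> is small compared
  with \<open>z\<close> because \<open>h\<close> is C1 and its derivative at \<open>c\<close> is injective (\<open>radial_remainder_small\<close>).
  Each coordinate \<open>u\<close> of the orbit of \<open>z\<close> therefore solves \<open>u' = a (u + g)\<close>, where \<open>g\<close> is the same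
  coordinate of the orbit of \<open>e\<close>. A solution that is bounded on the whole line is bounded by the
  supremum of \<open>g\<close> (\<open>bounded_solution_le_forcing\<close>), and that supremum is at most \<open>C\<close> times the norm of
  \<open>e\<close>. This makes \<open>z\<close> smaller than itself.

  If \<open>p\<close> is isolated, \<open>w\<close> has no other zero nearby, so on a small sphere around \<open>c\<close> the straight
  homotopies from \<open>w\<close> to \<open>y - c\<close> and from \<open>w\<close> to \<open>c - y\<close> have no zeros
  (\<open>sphere_degree_nowhere_radial\<close>). The first one shows that the index is the degree of the identity,
  which is \<open>1\<close>. The second one shows that it is the degree of the antipodal map, which is
  \<open>(- 1)\<^sup>d\<close>. Hence the index is \<open>1\<close> and \<open>d\<close> is even. In dimension \<open>0\<close>, where the sphere is empty,
  the index is \<open>1\<close> by convention.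
\<close>

section \<open>Degrees of maps of spheres\<close>

lemma continuous_map_nsphereI:
  assumes "\<And>i. continuous_map Z euclideanreal (\<lambda>z. f z i)"
    and "\<And>z. z \<in> topspace Z \<Longrightarrow> f z \<in> topspace (nsphere p)"
  shows "continuous_map Z (nsphere p) f"
  using assms
  by (auto simp: nsphere continuous_map_in_subtopology continuous_map_componentwise_UNIV)

text \<open>
  Swapping coordinates \<open>0\<close> and \<open>k\<close> is an involution, so its degree squares to \<open>1\<close>; conjugating
  with it turns the reflection in coordinate \<open>0\<close>, of degree \<open>-1\<close>, into the one in coordinate \<open>k\<close>.
\<close>

lemma Brouwer_degree2_coordinate_reflection:
  assumes "k \<le> p"
  shows "Brouwer_degree2 p (\<lambda>x i. if i = k then - x i else x i) = -1"
proof -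
  let ?t = "\<lambda>(x::nat \<Rightarrow> real) i. x (Transposition.transpose 0 k i)"
  let ?r = "\<lambda>j (x::nat \<Rightarrow> real) i. if i = j then - x i else x i"
  have perm: "bij_betw (Transposition.transpose 0 k) {..p} {..p}"
    using assms by (intro bij_betw_byWitness[where f' = "Transposition.transpose 0 k"]) (auto simp: Transposition.transpose_def)
  have t: "continuous_map (nsphere p) (nsphere p) ?t"
  proof (rule continuous_map_nsphereI)
    fix x assume "x \<in> topspace (nsphere p)"
    then show "?t x \<in> topspace (nsphere p)"
      using assms sum.reindex_bij_betw[OF perm, of "\<lambda>i. (x i)\<^sup>2"]
      by (auto simp: nsphere Transposition.transpose_def)
  qed (rule continuous_map_nsphere_projection)
  have r: "continuous_map (nsphere p) (nsphere p) (?r j)" for j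
    by (rule continuous_map_nsphere_reflection)
  have tt: "?t \<circ> ?t = id" by (auto simp: fun_eq_iff)
  have eq: "?r k = ?t \<circ> (?r 0 \<circ> ?t)"
    by (auto simp: fun_eq_iff Transposition.transpose_def)
  have "Brouwer_degree2 p ?t * Brouwer_degree2 p ?t = 1"
    using Brouwer_degree2_compose[OF t t] tt by simp
  moreover have "Brouwer_degree2 p (?r k)
      = Brouwer_degree2 p ?t * (Brouwer_degree2 p (?r 0) * Brouwer_degree2 p ?t)"
    unfolding eq
    by (subst Brouwer_degree2_compose[OF continuous_map_compose[OF t r] t])
       (subst Brouwer_degree2_compose[OF t r], simp)
  ultimately show ?thesis by (simp add: Brouwer_degree2_reflection)
qed

text \<open>
  The antipodal map is the composition of the reflections in all \<open>p + 1\<close> coordinates.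
\<close>

lemma Brouwer_degree2_antipodal: "Brouwer_degree2 p (\<lambda>x i. - x i) = (- 1) ^ Suc p"
proof -
  let ?a = "\<lambda>k (x::nat \<Rightarrow> real) i. if i < k then - x i else x i"
  have "continuous_map (nsphere p) (nsphere p) (?a k) \<and> Brouwer_degree2 p (?a k) = (- 1) ^ k"
    if "k \<le> Suc p" for k
    using that
  proof (induction k)
    case 0
    then show ?case using Brouwer_degree2_id[of p] by (simp add: id_def)
  next
    case (Suc k)
    let ?r = "\<lambda>(x::nat \<Rightarrow> real) i. if i = k then - x i else x i"
    have eq: "?a (Suc k) = ?r \<circ> ?a k" by (auto simp: fun_eq_iff)
    have r: "continuous_map (nsphere p) (nsphere p) ?r"
      by (rule continuous_map_nsphere_reflection)
    have IH: "continuous_map (nsphere p) (nsphere p) (?a k)" "Brouwer_degree2 p (?a k) = (- 1) ^ k"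
      using Suc by auto
    show ?case
      unfolding eq using Brouwer_degree2_compose[OF IH(1) r] continuous_map_compose[OF IH(1) r]
        IH(2) Brouwer_degree2_coordinate_reflection[of k p] Suc.prems by simp
  qed
  from this[of "Suc p"] have "Brouwer_degree2 p (?a (Suc p)) = (- 1) ^ Suc p" by blast
  moreover have "Brouwer_degree2 p (?a (Suc p)) = Brouwer_degree2 p (\<lambda>x i. - x i)"
    by (rule Brouwer_degree2_eq) (auto simp: nsphere fun_eq_iff)
  ultimately show ?thesis by simp
qed

lemma enorm_eq_0_iff: "enorm n x = 0 \<longleftrightarrow> (\<forall>i<n. x i = 0)"
  by (auto simp: enorm_def sum_nonneg_eq_0_iff)

lemma enorm_scale: "enorm n (\<lambda>i. a * x i) = \<bar>a\<bar> * enorm n x"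
  by (simp add: enorm_def power_mult_distrib real_sqrt_mult flip: sum_distrib_left)

lemma abs_le_enorm: "i < n \<Longrightarrow> \<bar>x i\<bar> \<le> enorm n x"
  unfolding enorm_def
  by (metis finite_lessThan lessThan_iff member_le_sum real_sqrt_abs real_sqrt_le_mono zero_le_power2)

lemma nsphere_iff:
  "x \<in> topspace (nsphere p) \<longleftrightarrow> x \<in> topspace (Euclidean_space (Suc p)) \<and> enorm (Suc p) x = 1"
  by (simp add: nsphere_def enorm_def lessThan_Suc_atMost)

lemma normalize_in_nsphere:
  assumes "y \<in> topspace (Euclidean_space (Suc p))" "\<exists>i<Suc p. y i \<noteq> 0"
  shows "(\<lambda>i. y i / enorm (Suc p) y) \<in> topspace (nsphere p)"
proof -
  have "enorm (Suc p) y \<noteq> 0" using assms(2) by (auto simp: enorm_eq_0_iff)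
  then have "enorm (Suc p) (\<lambda>i. inverse (enorm (Suc p) y) * y i) = 1"
    unfolding enorm_scale by (simp add: enorm_def sum_nonneg)
  then show ?thesis
    using assms(1) by (simp add: nsphere_iff topspace_Euclidean_space divide_inverse_commute)
qed

text \<open>
  Dividing a homotopy of nowhere vanishing maps by its norm gives a homotopy of sphere maps.
\<close>

lemma Brouwer_degree2_nonvanishing_homotopy:
  fixes H :: "real \<Rightarrow> (nat \<Rightarrow> real) \<Rightarrow> nat \<Rightarrow> real"
  assumes cont: "\<And>i. continuous_map (prod_topology (top_of_set {0..1::real}) (nsphere p)) euclideanreal
                    (\<lambda>z. H (fst z) (snd z) i)"
    and space: "\<And>t u. t \<in> {0..1::real} \<Longrightarrow> u \<in> topspace (nsphere p) \<Longrightarrow>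
                   H t u \<in> topspace (Euclidean_space (Suc p))"
    and nz: "\<And>t u. t \<in> {0..1::real} \<Longrightarrow> u \<in> topspace (nsphere p) \<Longrightarrow> \<exists>i<Suc p. H t u i \<noteq> 0"
  shows "Brouwer_degree2 p (\<lambda>u i. H 0 u i / enorm (Suc p) (H 0 u))
       = Brouwer_degree2 p (\<lambda>u i. H 1 u i / enorm (Suc p) (H 1 u))"
proof (rule Brouwer_degree2_homotopic)
  let ?h = "\<lambda>z i. H (fst z) (snd z) i / enorm (Suc p) (H (fst z) (snd z))"
  have "continuous_map (prod_topology (top_of_set {0..1::real}) (nsphere p)) (nsphere p) ?h"
  proof (rule continuous_map_nsphereI)
    fix i
    have "continuous_map (prod_topology (top_of_set {0..1::real}) (nsphere p)) euclideanreal
            (\<lambda>z. enorm (Suc p) (H (fst z) (snd z)))"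
      unfolding enorm_def by (intro continuous_intros cont) auto
    moreover have "enorm (Suc p) (H (fst z) (snd z)) \<noteq> 0"
      if "z \<in> topspace (prod_topology (top_of_set {0..1::real}) (nsphere p))" for z
      using nz[of "fst z" "snd z"] that by (auto simp: enorm_eq_0_iff)
    ultimately show "continuous_map (prod_topology (top_of_set {0..1::real}) (nsphere p)) euclideanreal
            (\<lambda>z. ?h z i)"
      by (intro continuous_map_real_divide cont)
  next
    fix z assume "z \<in> topspace (prod_topology (top_of_set {0..1::real}) (nsphere p))"
    then show "?h z \<in> topspace (nsphere p)"
      by (intro normalize_in_nsphere space nz) auto
  qed
  then show "homotopic_with (\<lambda>x. True) (nsphere p) (nsphere p)
     (\<lambda>u i. H 0 u i / enorm (Suc p) (H 0 u)) (\<lambda>u i. H 1 u i / enorm (Suc p) (H 1 u))"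
    by (auto simp: homotopic_with intro!: exI[of _ ?h])
qed

text \<open>
  If a field is nowhere radial on the sphere of radius \<open>\<epsilon>\<close>, then the segment from it to the outward
  radial field and the segment from it to the inward radial field both avoid \<open>0\<close>. So its degree is
  that of the identity and also that of the antipodal map, which determines the degree and the
  parity of \<open>d\<close> together. Shrinking the radius from \<open>r\<close> to \<open>\<epsilon>\<close> does not meet a zero of the field.
\<close>

lemma sphere_degree_nowhere_radial:
  assumes "0 < d"
    and c: "c \<in> topspace (Euclidean_space d)"
    and w_cont: "\<And>i. continuous_map (subtopology (Euclidean_space d) (closed_ball d c r))
                    euclideanreal (\<lambda>y. w y i)"
    and w_space: "\<And>y. y \<in> closed_ball d c r \<Longrightarrow> w y \<in> topspace (Euclidean_space d)"
    and w_nz: "\<And>y. y \<in> closed_ball d c r \<Longrightarrow> y \<noteq> c \<Longrightarrow> \<exists>i<d. w y i \<noteq> 0"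
    and \<epsilon>: "0 < \<epsilon>" "\<epsilon> \<le> r"
    and not_radial: "\<And>y a. y \<in> topspace (Euclidean_space d) \<Longrightarrow> enorm d (\<lambda>i. y i - c i) = \<epsilon> \<Longrightarrow> a \<noteq> 0 \<Longrightarrow>
                    \<exists>i<d. w y i \<noteq> a * (y i - c i)"
  shows "sphere_degree d w c r = 1 \<and> even d"
proof -
  define p where "p = d - 1"
  have d: "d = Suc p" using \<open>0 < d\<close> by (simp add: p_def)
  have on_ball: "(\<lambda>i. c i + s * u i) \<in> closed_ball d c r" "(\<lambda>i. c i + s * u i) \<noteq> c"
    "(\<lambda>i. c i + s * u i) \<in> topspace (Euclidean_space d)"
    "enorm d (\<lambda>i. (c i + s * u i) - c i) = s"
    if "u \<in> topspace (nsphere p)" "0 < s" "s \<le> r" for s u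
  proof -
    have u: "u \<in> topspace (Euclidean_space d)" "enorm d u = 1"
      using that by (auto simp: nsphere_iff d)
    show "(\<lambda>i. c i + s * u i) \<in> topspace (Euclidean_space d)"
      using u c by (auto simp: topspace_Euclidean_space)
    show n: "enorm d (\<lambda>i. (c i + s * u i) - c i) = s"
      using u that by (simp add: enorm_scale)
    show "(\<lambda>i. c i + s * u i) \<in> closed_ball d c r"
      using u c that n by (auto simp: closed_ball_def topspace_Euclidean_space)
    show "(\<lambda>i. c i + s * u i) \<noteq> c"
    proof
      assume "(\<lambda>i. c i + s * u i) = c"
      then have "s * u i = 0" for i by (metis add_cancel_right_right)
      then show False using u(2) that(2) by (simp add: enorm_def)
    qed
  qed
  let ?Z = "prod_topology (top_of_set {0..1::real}) (nsphere p)"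
  have u_cont: "continuous_map ?Z euclideanreal (\<lambda>z. snd z i)" for i
    using continuous_map_compose[OF continuous_map_snd continuous_map_nsphere_projection]
    by (simp add: o_def)
  have t_cont: "continuous_map ?Z euclideanreal fst"
    using continuous_map_into_fulltopology[OF continuous_map_fst] .
  have wH_cont: "continuous_map ?Z euclideanreal (\<lambda>z. w (\<lambda>i. c i + s (fst z) * snd z i) j)"
    if "\<And>t. t \<in> {0..1} \<Longrightarrow> 0 < s t \<and> s t \<le> r" "continuous_map ?Z euclideanreal (\<lambda>z. s (fst z))" for s j
  proof -
    have "continuous_map ?Z (subtopology (Euclidean_space d) (closed_ball d c r))
            (\<lambda>z i. c i + s (fst z) * snd z i)"
      unfolding continuous_map_in_subtopology Euclidean_space_def continuous_map_componentwise_UNIV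
    proof (intro conjI allI)
      show "continuous_map ?Z euclideanreal (\<lambda>z. c i + s (fst z) * snd z i)" for i
        by (intro continuous_intros that u_cont)
    qed (use on_ball that in \<open>auto simp: topspace_Euclidean_space\<close>)
    from continuous_map_compose[OF this w_cont[of j]] show ?thesis by (simp add: o_def)
  qed
  let ?w = "\<lambda>u. w (\<lambda>i. c i + \<epsilon> * u i)"
  have "Brouwer_degree2 p (\<lambda>u i. w (\<lambda>i. c i + r * u i) i / enorm d (w (\<lambda>i. c i + r * u i)))
      = Brouwer_degree2 p (\<lambda>u i. ?w u i / enorm d (?w u))"
  proof -
    \<comment> \<open>The radius at time \<open>t\<close> of the shrinking sphere.\<close>
    define s where "s t = (1 - t) * r + t * \<epsilon>" for t
    have s: "0 < s t" "s t \<le> r" if "t \<in> {0..1}" for t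
    proof -
      have "0 < \<epsilon>" "\<epsilon> \<le> (1 - t) * r + t * \<epsilon>"
        using that \<epsilon> mult_left_mono[of \<epsilon> r "1 - t"] by (auto simp: algebra_simps)
      then show "0 < s t" by (simp add: s_def)
      show "s t \<le> r" using that \<epsilon> mult_left_mono[of \<epsilon> r t] by (auto simp: s_def algebra_simps)
    qed
    have "Brouwer_degree2 p (\<lambda>u i. w (\<lambda>i. c i + s 0 * u i) i / enorm (Suc p) (w (\<lambda>i. c i + s 0 * u i)))
        = Brouwer_degree2 p (\<lambda>u i. w (\<lambda>i. c i + s 1 * u i) i / enorm (Suc p) (w (\<lambda>i. c i + s 1 * u i)))"
    proof (rule Brouwer_degree2_nonvanishing_homotopy)
      show "continuous_map ?Z euclideanreal (\<lambda>z. w (\<lambda>i. c i + s (fst z) * snd z i) i)" for i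
        by (rule wH_cont) (use s in \<open>auto simp: s_def intro!: continuous_intros t_cont\<close>)
    qed (use s on_ball w_space w_nz in \<open>auto simp flip: d\<close>)
    then show ?thesis by (simp add: s_def d)
  qed
  \<comment> \<open>The outward case is \<open>b = 1\<close>, the inward case is \<open>b = - 1\<close>.\<close>
  also have radial: "\<dots> = Brouwer_degree2 p (\<lambda>u i. b * u i)" if b: "b = 1 \<or> b = - 1" for b
  proof -
    define H where "H t u i = (1 - t) * ?w u i + t * (b * u i)" for t u i
    have "Brouwer_degree2 p (\<lambda>u i. H 0 u i / enorm (Suc p) (H 0 u))
        = Brouwer_degree2 p (\<lambda>u i. H 1 u i / enorm (Suc p) (H 1 u))"
    proof (rule Brouwer_degree2_nonvanishing_homotopy)
      show "continuous_map ?Z euclideanreal (\<lambda>z. H (fst z) (snd z) i)" for i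
        unfolding H_def using \<epsilon> 
        by (intro continuous_intros u_cont t_cont wH_cont[of "\<lambda>_. \<epsilon>"]) auto
    next
      fix t u assume t: "t \<in> {0..1::real}" and u: "u \<in> topspace (nsphere p)"
      note B = on_ball[OF u \<epsilon>]
      show "H t u \<in> topspace (Euclidean_space (Suc p))"
        using w_space[OF B(1)] u by (auto simp: H_def topspace_Euclidean_space d nsphere_iff)
      have "\<exists>i<Suc p. u i \<noteq> 0"
        using u enorm_eq_0_iff[of "Suc p" u] by (auto simp: nsphere_iff)
      show "\<exists>i<Suc p. H t u i \<noteq> 0"
      proof (cases "t = 0 \<or> t = 1")
        case True
        then show ?thesis
          using w_nz[OF B(1,2)] \<open>\<exists>i<Suc p. u i \<noteq> 0\<close> b by (auto simp: H_def d)
      next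
        case False
        \<comment> \<open>A zero of the homotopy would make the field the radial multiple \<open>- t b / ((1 - t) \<epsilon>)\<close>.\<close>
        let ?a = "- (t * b) / ((1 - t) * \<epsilon>)"
        have "?a \<noteq> 0" using False b \<epsilon> by auto
        from not_radial[OF B(3,4) this] obtain i
          where i: "i < d" "?w u i \<noteq> ?a * (c i + \<epsilon> * u i - c i)" by auto
        have "H t u i \<noteq> 0"
        proof
          assume "H t u i = 0"
          then have "(1 - t) * ?w u i = - (t * b) * u i" by (simp add: H_def)
          then have "?w u i = - (t * b) * u i / (1 - t)"
            using False by (intro eq_divide_imp) (auto simp: mult.commute)
          then have "?w u i = ?a * (c i + \<epsilon> * u i - c i)"
            using False \<epsilon> by simp
          then show False using i by simp
        qed
        then show ?thesis using i d by auto
      qed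
    qed
    moreover have "Brouwer_degree2 p (\<lambda>u i. H 1 u i / enorm (Suc p) (H 1 u)) = Brouwer_degree2 p (\<lambda>u i. b * u i)"
      using b by (intro Brouwer_degree2_eq) (auto simp: H_def[abs_def] enorm_scale nsphere_iff fun_eq_iff)
    ultimately show ?thesis by (simp add: H_def[abs_def] d)
  qed
  finally have deg: "sphere_degree d w c r = Brouwer_degree2 p (\<lambda>u i. b * u i)" if "b = 1 \<or> b = - 1" for b
    using that \<open>0 < d\<close> by (simp add: sphere_degree_def Let_def p_def)
  have "sphere_degree d w c r = 1"
    using deg[of 1] Brouwer_degree2_id[of p] by (simp add: id_def)
  moreover have "sphere_degree d w c r = (- 1) ^ d"
    using deg[of "-1"] Brouwer_degree2_antipodal[of p] d by simp
  ultimately show ?thesis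
    by (metis neg_one_odd_power one_neq_neg_one)
qed

section \<open>Linear families with bounded orbits\<close>

text \<open>
  The model is a space of vectors with a basis \<open>b\<close> in reduced echelon form with pivot columns \<open>I\<close>:
  the coefficients of a vector are then its own entries at the pivots, so they depend linearly on the
  vector and are bounded by its norm.
\<close>

definition coordinate_span :: "nat \<Rightarrow> nat set \<Rightarrow> (nat \<Rightarrow> nat \<Rightarrow> real) \<Rightarrow> (nat \<Rightarrow> real) \<Rightarrow> bool" where
  "coordinate_span n I b z \<longleftrightarrow> (\<forall>j<n. z j = (\<Sum>i\<in>I. z i * b i j))"

text \<open>
  Gaussian elimination, one column at a time: if some \<open>z0\<close> in \<open>S\<close> is not reproduced in the new column
  \<open>n\<close>, its defect \<open>e\<close> vanishes in the old columns, becomes the pivot row for column \<open>n\<close> after scaling,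
  and is used to clear that column in the old rows. The predicate \<open>P\<close> stands for any property passed on
  to linear combinations, and so records that the rows \<open>b i\<close> are combinations of elements of \<open>S\<close>.
\<close>

lemma coordinate_basis:
  fixes S :: "(nat \<Rightarrow> real) set" and P :: "(nat \<Rightarrow> real) \<Rightarrow> bool"
  assumes S: "\<And>z. z \<in> S \<Longrightarrow> P z"
    and comb: "\<And>x y a. P x \<Longrightarrow> P y \<Longrightarrow> P (\<lambda>j. x j + a * y j)"
  shows "\<exists>I b. I \<subseteq> {..<n} \<and> (\<forall>i\<in>I. P (b i)) \<and> (\<forall>z\<in>S. coordinate_span n I b z)"
  unfolding coordinate_span_def
proof (induction n)
  case 0
  then show ?case by auto
next
  case (Suc n)
  then obtain I b where I: "I \<subseteq> {..<n}" and b: "\<And>i. i \<in> I \<Longrightarrow> P (b i)"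
    and eq: "\<And>z j. z \<in> S \<Longrightarrow> j < n \<Longrightarrow> z j = (\<Sum>i\<in>I. z i * b i j)" by blast
  have "finite I" "n \<notin> I" using I finite_subset by auto
  show ?case
  proof (cases "\<forall>z\<in>S. z n = (\<Sum>i\<in>I. z i * b i n)")
    case True
    then have "\<forall>z\<in>S. \<forall>j<Suc n. z j = (\<Sum>i\<in>I. z i * b i j)"
      using eq by (auto simp: less_Suc_eq)
    then show ?thesis using I b by (intro exI[of _ I] exI[of _ b]) auto
  next
    case False
    then obtain z0 where z0: "z0 \<in> S" "z0 n \<noteq> (\<Sum>i\<in>I. z0 i * b i n)" by blast
    define e where "e j = z0 j + (\<Sum>i\<in>I. (- z0 i) * b i j)" for j
    have "P (\<lambda>j. z0 j + (\<Sum>i\<in>J. (- z0 i) * b i j))" if "J \<subseteq> I" for J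
      using finite_subset[OF that \<open>finite I\<close>] that
    proof (induction J rule: finite_induct)
      case empty
      then show ?case using S[OF z0(1)] by simp
    next
      case (insert k J)
      then have "P (\<lambda>j. (z0 j + (\<Sum>i\<in>J. (- z0 i) * b i j)) + (- z0 k) * b k j)"
        by (intro comb b) auto
      then show ?case using insert.hyps by (simp add: algebra_simps)
    qed
    from this[of I] have Pe: "P e" by (simp add: e_def[abs_def])
    have e_less: "e j = 0" if "j < n" for j
      using eq[OF z0(1) that] by (simp add: e_def sum_negf)
    have e_n: "e n \<noteq> 0" using z0(2) by (simp add: e_def sum_negf)
    define b' where "b' i j = (if i = n then e j / e n else b i j - b i n * (e j / e n))" for i j
    have "P (b' i)" if "i \<in> insert n I" for i
    proof (cases "i = n")
      case True
      have "P (\<lambda>j. e j + (1 / e n - 1) * e j)" by (intro comb Pe)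
      then show ?thesis by (simp add: True b'_def[abs_def] field_simps)
    next
      case False
      have "P (\<lambda>j. b i j + (- b i n / e n) * e j)" using False that by (intro comb Pe b) auto
      then show ?thesis using False by (simp add: b'_def[abs_def])
    qed
    moreover have "z j = (\<Sum>i\<in>insert n I. z i * b' i j)" if z: "z \<in> S" and j: "j < Suc n" for z j
    proof -
      define q where "q = e j / e n"
      have "(\<Sum>i\<in>insert n I. z i * b' i j) = z n * q + (\<Sum>i\<in>I. z i * (b i j - b i n * q))"
        using \<open>finite I\<close> \<open>n \<notin> I\<close> by (auto simp: b'_def q_def intro!: sum.cong)
      also have "\<dots> = z n * q + (\<Sum>i\<in>I. z i * b i j) - (\<Sum>i\<in>I. z i * b i n) * q"
        by (simp add: right_diff_distrib sum_subtractf sum_distrib_right mult.assoc)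
      also have "\<dots> = z j"
        using eq[OF z] e_less[of j] e_n j by (cases "j = n") (auto simp: q_def)
      finally show ?thesis by simp
    qed
    ultimately show ?thesis
      using I by (intro exI[of _ "insert n I"] exI[of _ b']) auto
  qed
qed

text \<open>
  A uniform boundedness principle: a family of matrices that is bounded on each vector of \<open>S\<close> is
  bounded on each of the finitely many vectors \<open>b i\<close>, hence uniformly on their span.
\<close>

lemma orbits_uniformly_bounded:
  fixes E :: "'t \<Rightarrow> nat \<Rightarrow> nat \<Rightarrow> real" and S :: "(nat \<Rightarrow> real) set"
  assumes bdd: "\<And>z. z \<in> S \<Longrightarrow> \<exists>K. \<forall>t. \<forall>k<n. \<bar>\<Sum>j<n. E t k j * z j\<bar> \<le> K"
  obtains I C b where "I \<subseteq> {..<n}" "0 < C"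
    "\<And>z. z \<in> S \<Longrightarrow> coordinate_span n I b z"
    "\<And>z t k. coordinate_span n I b z \<Longrightarrow> k < n \<Longrightarrow>
       \<bar>\<Sum>j<n. E t k j * z j\<bar> \<le> C * (\<Sum>i<n. \<bar>z i\<bar>)"
proof -
  define P where "P z \<longleftrightarrow> (\<exists>K. \<forall>t. \<forall>k<n. \<bar>\<Sum>j<n. E t k j * z j\<bar> \<le> K)" for z
  have comb: "P (\<lambda>j. x j + a * y j)" if x: "P x" and y: "P y" for x y a
  proof -
    obtain K where K: "\<And>t k. k < n \<Longrightarrow> \<bar>\<Sum>j<n. E t k j * x j\<bar> \<le> K" using x by (auto simp: P_def)
    obtain L where L: "\<And>t k. k < n \<Longrightarrow> \<bar>\<Sum>j<n. E t k j * y j\<bar> \<le> L" using y by (auto simp: P_def)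
    have "\<bar>\<Sum>j<n. E t k j * (x j + a * y j)\<bar> \<le> K + \<bar>a\<bar> * L" if "k < n" for t k
    proof -
      have "(\<Sum>j<n. E t k j * (x j + a * y j)) = (\<Sum>j<n. E t k j * x j) + a * (\<Sum>j<n. E t k j * y j)"
        by (simp add: distrib_left sum.distrib sum_distrib_left mult.left_commute)
      also have "\<bar>\<dots>\<bar> \<le> K + \<bar>a\<bar> * L"
        using K[OF that, of t] mult_left_mono[OF L[OF that, of t] abs_ge_zero[of a]]
        by (metis (no_types, lifting) abs_mult abs_triangle_ineq add_mono order_trans)
      finally show ?thesis .
    qed
    then show ?thesis by (auto simp: P_def)
  qed
  have "\<exists>I b. I \<subseteq> {..<n} \<and> (\<forall>i\<in>I. P (b i)) \<and> (\<forall>z\<in>S. coordinate_span n I b z)"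
    by (rule coordinate_basis) (use bdd comb in \<open>auto simp: P_def\<close>)
  then obtain I b where I: "I \<subseteq> {..<n}" and b: "\<And>i. i \<in> I \<Longrightarrow> P (b i)"
    and eq: "\<And>z. z \<in> S \<Longrightarrow> coordinate_span n I b z"
    by blast
  obtain K where K: "\<And>i t k. i \<in> I \<Longrightarrow> k < n \<Longrightarrow> \<bar>\<Sum>j<n. E t k j * b i j\<bar> \<le> K i"
    using b unfolding P_def by metis
  have "finite I" using I finite_subset by auto
  define C where "C = 1 + (\<Sum>i\<in>I. \<bar>K i\<bar>)"
  have "0 < C" by (simp add: C_def add_pos_nonneg sum_nonneg)
  have "\<bar>\<Sum>j<n. E t k j * z j\<bar> \<le> C * (\<Sum>i<n. \<bar>z i\<bar>)"
    if z: "coordinate_span n I b z" and k: "k < n" for z t k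
  proof -
    have "(\<Sum>j<n. E t k j * z j) = (\<Sum>j<n. E t k j * (\<Sum>i\<in>I. z i * b i j))"
      using z by (auto simp: coordinate_span_def intro!: sum.cong)
    also have "\<dots> = (\<Sum>i\<in>I. z i * (\<Sum>j<n. E t k j * b i j))"
      by (simp add: sum_distrib_left mult.left_commute sum.swap[of _ I])
    also have "\<bar>\<dots>\<bar> \<le> (\<Sum>i\<in>I. \<bar>z i\<bar> * C)"
    proof (rule order_trans[OF sum_abs sum_mono])
      fix i assume "i \<in> I"
      then have "\<bar>K i\<bar> \<le> (\<Sum>i\<in>I. \<bar>K i\<bar>)" using \<open>finite I\<close> by (intro member_le_sum) auto
      then have "\<bar>\<Sum>j<n. E t k j * b i j\<bar> \<le> C"
        using K[OF \<open>i \<in> I\<close> k, of t] by (simp add: C_def)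
      then show "\<bar>z i * (\<Sum>j<n. E t k j * b i j)\<bar> \<le> \<bar>z i\<bar> * C"
        by (simp add: abs_mult mult_left_mono)
    qed
    also have "\<dots> \<le> (\<Sum>i<n. \<bar>z i\<bar> * C)"
      using I \<open>0 < C\<close> by (intro sum_mono2) auto
    finally show ?thesis by (simp add: sum_distrib_left mult.commute)
  qed
  with I \<open>0 < C\<close> eq show ?thesis by (rule that)
qed

text \<open>
  The same basis, taken for the image of an injective linear map, expresses \<open>v\<close> linearly in terms of
  the image of \<open>v\<close>.
\<close>

lemma injective_bounded_below:
  fixes a :: "nat \<Rightarrow> nat \<Rightarrow> real"
  assumes inj: "\<And>v. v \<in> topspace (Euclidean_space m) \<Longrightarrow> (\<And>j. j < n \<Longrightarrow> (\<Sum>i<m. a j i * v i) = 0) \<Longrightarrow> v = (\<lambda>_. 0)"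
  obtains C where "0 < C"
    "\<And>v. v \<in> topspace (Euclidean_space m) \<Longrightarrow> (\<Sum>i<m. \<bar>v i\<bar>) \<le> C * (\<Sum>j<n. \<bar>\<Sum>i<m. a j i * v i\<bar>)"
proof -
  define L where "L v = (\<lambda>j. \<Sum>i<m. a j i * v i)" for v
  define P where "P z \<longleftrightarrow> (\<exists>v \<in> topspace (Euclidean_space m). z = L v)" for z
  have comb: "P (\<lambda>j. x j + s * y j)" if "P x" "P y" for x y s
  proof -
    obtain v where v: "v \<in> topspace (Euclidean_space m)" "x = L v"
      using \<open>P x\<close> by (auto simp: P_def)
    obtain w where w: "w \<in> topspace (Euclidean_space m)" "y = L w"
      using \<open>P y\<close> by (auto simp: P_def)
    from v w show ?thesis
      unfolding P_def
      by (intro bexI[of _ "\<lambda>i. v i + s * w i"])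
         (auto simp: L_def fun_eq_iff topspace_Euclidean_space distrib_left sum.distrib
            sum_distrib_left mult.left_commute)
  qed
  have "\<exists>I b. I \<subseteq> {..<n} \<and> (\<forall>i\<in>I. P (b i)) \<and> (\<forall>z\<in>{z. P z}. coordinate_span n I b z)"
    by (rule coordinate_basis) (use comb in auto)
  then obtain I b where I: "I \<subseteq> {..<n}" and b: "\<And>i. i \<in> I \<Longrightarrow> P (b i)"
    and eq: "\<And>z. P z \<Longrightarrow> coordinate_span n I b z"
    by blast
  obtain V where V: "\<And>i. i \<in> I \<Longrightarrow> V i \<in> topspace (Euclidean_space m) \<and> b i = L (V i)"
    using b unfolding P_def by metis
  have "finite I" using I finite_subset by auto
  define C where "C = 1 + (\<Sum>k\<in>I. \<Sum>i<m. \<bar>V k i\<bar>)"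
  have "0 < C" by (simp add: C_def add_pos_nonneg sum_nonneg)
  moreover have "(\<Sum>i<m. \<bar>v i\<bar>) \<le> C * (\<Sum>j<n. \<bar>\<Sum>i<m. a j i * v i\<bar>)"
    if v: "v \<in> topspace (Euclidean_space m)" for v
  proof -
    define v' where "v' i = v i - (\<Sum>k\<in>I. L v k * V k i)" for i
    have "v' = (\<lambda>_. 0)"
    proof (rule inj)
      show "v' \<in> topspace (Euclidean_space m)"
        using v V by (auto simp: v'_def topspace_Euclidean_space intro!: sum.neutral)
      fix j assume j: "j < n"
      have "(\<Sum>i<m. a j i * v' i) = L v j - (\<Sum>k\<in>I. L v k * L (V k) j)"
        by (simp add: v'_def L_def right_diff_distrib sum_subtractf sum_distrib_left
            mult.left_commute sum.swap[of _ I])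
      also have "\<dots> = 0"
        using eq[of "L v"] j v V by (auto simp: P_def coordinate_span_def)
      finally show "(\<Sum>i<m. a j i * v' i) = 0" .
    qed
    then have v_eq: "v i = (\<Sum>k\<in>I. L v k * V k i)" for i
      by (simp add: v'_def fun_eq_iff)
    have "(\<Sum>i<m. \<bar>v i\<bar>) \<le> (\<Sum>i<m. \<Sum>k\<in>I. \<bar>L v k\<bar> * \<bar>V k i\<bar>)"
      by (rule sum_mono) (subst v_eq, rule order_trans[OF sum_abs], simp add: abs_mult)
    also have "\<dots> = (\<Sum>k\<in>I. \<bar>L v k\<bar> * (\<Sum>i<m. \<bar>V k i\<bar>))"
      by (simp add: sum_distrib_left sum.swap[of _ I])
    also have "\<dots> \<le> (\<Sum>k\<in>I. \<bar>L v k\<bar> * C)"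
    proof (intro sum_mono mult_left_mono)
      fix k assume "k \<in> I"
      then have "(\<Sum>i<m. \<bar>V k i\<bar>) \<le> (\<Sum>k\<in>I. \<Sum>i<m. \<bar>V k i\<bar>)"
        using \<open>finite I\<close> by (intro member_le_sum) (auto intro: sum_nonneg)
      then show "(\<Sum>i<m. \<bar>V k i\<bar>) \<le> C" by (simp add: C_def)
    qed auto
    also have "\<dots> \<le> (\<Sum>k<n. \<bar>L v k\<bar> * C)"
      using I \<open>0 < C\<close> by (intro sum_mono2) auto
    finally show ?thesis by (simp add: sum_distrib_left L_def mult.commute)
  qed
  ultimately show ?thesis by (rule that)
qed

section \<open>Bounded solutions of a scalar linear equation\<close>

text \<open>
  Multiplied by \<open>exp (- l t)\<close>, the function \<open>u - \<eta>\<close> becomes nondecreasing, and it tends to \<open>0\<close> as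
  \<open>t\<close> grows because \<open>u\<close> is bounded; so it is never positive.
\<close>

lemma bounded_solution_upper:
  fixes u g :: "real \<Rightarrow> real"
  assumes "0 < l" and ode: "\<And>s. (u has_real_derivative l * (u s + g s)) (at s)"
    and u: "\<And>s. \<bar>u s\<bar> \<le> K" and g: "\<And>s. \<bar>g s\<bar> \<le> \<eta>"
  shows "u s \<le> \<eta>"
proof -
  define \<phi> where "\<phi> t = exp (- l * t) * (u t - \<eta>)" for t
  have der: "(\<phi> has_real_derivative exp (- l * t) * (l * (g t + \<eta>))) (at t)" for t
    unfolding \<phi>_def by (rule derivative_eq_intros refl ode)+ (simp add: algebra_simps)
  have "\<phi> s \<le> \<phi> t" if "s \<le> t" for t
  proof (rule DERIV_nonneg_imp_nondecreasing[OF that])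
    fix x
    have "0 \<le> g x + \<eta>" using g[of x] by linarith
    then show "\<exists>y. (\<phi> has_real_derivative y) (at x) \<and> 0 \<le> y"
      using der[of x] \<open>0 < l\<close> by (intro exI[of _ "exp (- l * x) * (l * (g x + \<eta>))"]) auto
  qed
  then have ev: "\<forall>\<^sub>F t in at_top. \<phi> s \<le> \<phi> t"
    using eventually_ge_at_top[of s] by (rule eventually_mono[rotated])
  have "(\<phi> \<longlongrightarrow> 0) at_top"
  proof (rule Lim_null_comparison)
    show "\<forall>\<^sub>F t in at_top. norm (\<phi> t) \<le> exp (- l * t) * (K + \<bar>\<eta>\<bar>)"
    proof (rule always_eventually, rule allI)
      fix t
      have "\<bar>u t - \<eta>\<bar> \<le> K + \<bar>\<eta>\<bar>" using u[of t] by linarith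
      then show "norm (\<phi> t) \<le> exp (- l * t) * (K + \<bar>\<eta>\<bar>)" by (simp add: \<phi>_def abs_mult)
    qed
    show "((\<lambda>t. exp (- l * t) * (K + \<bar>\<eta>\<bar>)) \<longlongrightarrow> 0) at_top"
      using \<open>0 < l\<close> by real_asymp
  qed
  then have "\<phi> s \<le> 0" using ev by (rule tendsto_lowerbound) simp
  then show ?thesis by (simp add: \<phi>_def mult_le_0_iff)
qed

text \<open>
  On the whole line the equation \<open>u' = l (u + g)\<close> has no bounded solution larger than its forcing term.
  The sign of \<open>u\<close> and the sign of \<open>l\<close> are reduced to the previous estimate by negating \<open>u\<close> and by
  reversing time.
\<close>

lemma bounded_solution_le_forcing:
  fixes u g :: "real \<Rightarrow> real"
  assumes "l \<noteq> 0" and ode: "\<And>s. (u has_real_derivative l * (u s + g s)) (at s)"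
    and u: "\<And>s. \<bar>u s\<bar> \<le> K" and g: "\<And>s. \<bar>g s\<bar> \<le> \<eta>"
  shows "\<bar>u s\<bar> \<le> \<eta>"
proof -
  have pos: "\<bar>v s\<bar> \<le> \<eta>"
    if "0 < k" and v: "\<And>s. (v has_real_derivative k * (v s + h s)) (at s)"
      and "\<And>s. \<bar>v s\<bar> \<le> K" "\<And>s. \<bar>h s\<bar> \<le> \<eta>" for k v h and s :: real
  proof -
    have "((\<lambda>s. - v s) has_real_derivative k * (- v s + - h s)) (at s)" for s
      by (rule derivative_eq_intros v refl)+ (simp add: algebra_simps)
    then have "- v s \<le> \<eta>"
      using bounded_solution_upper[of k "\<lambda>s. - v s" "\<lambda>s. - h s" K \<eta> s] that by simp
    moreover have "v s \<le> \<eta>" using bounded_solution_upper[of k v h K \<eta> s] that by simp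
    ultimately show ?thesis by linarith
  qed
  show ?thesis
  proof (cases "0 < l")
    case True
    then show ?thesis using pos[of l u g s] ode u g by blast
  next
    case False
    have "((\<lambda>s. u (- s)) has_real_derivative l * (u (- s) + g (- s)) * - 1) (at s)" for s
      by (rule DERIV_chain2[OF ode]) (auto intro!: derivative_eq_intros)
    then show ?thesis
      using pos[of "- l" "\<lambda>s. u (- s)" "\<lambda>s. g (- s)" "- s"] False \<open>l \<noteq> 0\<close> u g by simp
  qed
qed

section \<open>C1 maps in coordinates\<close>

definition cube :: "nat \<Rightarrow> (nat \<Rightarrow> real) \<Rightarrow> real \<Rightarrow> (nat \<Rightarrow> real) set" where
  "cube m c r = {x \<in> topspace (Euclidean_space m). \<forall>i<m. \<bar>x i - c i\<bar> \<le> r}"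

lemma openin_contains_cube:
  assumes "openin (Euclidean_space m) W" "c \<in> W"
  shows "\<exists>r>0. cube m c r \<subseteq> W"
proof -
  obtain T where T: "openin (powertop_real UNIV) T" "W = T \<inter> {x. \<forall>i\<ge>m. x i = 0}"
    using assms(1) by (auto simp: Euclidean_space_def openin_subtopology)
  obtain U where U: "c \<in> (\<Pi>\<^sub>E i\<in>UNIV. U i)" "\<And>i. open (U i)" "(\<Pi>\<^sub>E i\<in>UNIV. U i) \<subseteq> T"
    using product_topology_open_contains_basis[OF T(1), of c] assms(2) T(2) by auto
  have "\<forall>i. \<exists>e>0. ball (c i) e \<subseteq> U i"
    using U(1,2) by (auto simp: PiE_iff intro: openE)
  then obtain e where e: "\<And>i. e i > 0" "\<And>i. ball (c i) (e i) \<subseteq> U i" by metis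
  define r where "r = Min (insert 1 (e ` {..<m})) / 2"
  have r: "0 < r" "i < m \<Longrightarrow> r < e i" for i
  proof -
    have M: "0 < Min (insert 1 (e ` {..<m}))" using e by (subst Min_gr_iff) auto
    then show "0 < r" by (simp add: r_def)
    assume "i < m"
    then have "Min (insert 1 (e ` {..<m})) \<le> e i" by (intro Min_le) auto
    then show "r < e i" using M unfolding r_def by linarith
  qed
  have "cube m c r \<subseteq> W"
  proof
    fix x assume x: "x \<in> cube m c r"
    have "x i \<in> U i" for i
    proof (cases "i < m")
      case True
      then have "x i \<in> ball (c i) (e i)"
        using x r(2)[OF True] by (auto simp: cube_def dist_real_def abs_minus_commute)
      then show ?thesis using e(2) by blast
    next
      case False
      then have "x i = c i" using x assms(2) T(2) by (auto simp: cube_def topspace_Euclidean_space)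
      then show ?thesis using U(1) by (auto simp: PiE_iff)
    qed
    then show "x \<in> W" using U(3) x T(2) by (auto simp: PiE_iff cube_def topspace_Euclidean_space)
  qed
  then show ?thesis using r(1) by blast
qed

lemma eventually_nhdsin_cube:
  assumes "\<forall>\<^sub>F x in nhdsin (Euclidean_space m) c. Q x" "c \<in> topspace (Euclidean_space m)"
  obtains r where "0 < r" "\<And>x. x \<in> cube m c r \<Longrightarrow> Q x"
  using assms openin_contains_cube[of m _ c] by (force simp: eventually_nhdsin)

lemma C1_on_partials_nearly_constant:
  assumes f: "C1_on m n W f" and W: "openin (Euclidean_space m) W" and c: "c \<in> W" and "0 < \<epsilon>"
  obtains r where "0 < r" "cube m c r \<subseteq> W"
    "\<And>x i j. x \<in> cube m c r \<Longrightarrow> i < m \<Longrightarrow> j < n \<Longrightarrow>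
       \<bar>partial_deriv i (\<lambda>y. f y j) x - partial_deriv i (\<lambda>y. f y j) c\<bar> \<le> \<epsilon>"
proof -
  have cW: "c \<in> topspace (Euclidean_space m)" using W c openin_subset by blast
  have ev: "\<forall>\<^sub>F x in nhdsin (Euclidean_space m) c.
      \<bar>partial_deriv i (\<lambda>y. f y j) x - partial_deriv i (\<lambda>y. f y j) c\<bar> \<le> \<epsilon>"
    if "i < m" "j < n" for i j
  proof -
    let ?p = "partial_deriv i (\<lambda>y. f y j)"
    have cont: "continuous_map (subtopology (Euclidean_space m) W) euclideanreal ?p"
      using f that by (simp add: C1_on_def)
    have "openin (subtopology (Euclidean_space m) W)
            {x \<in> topspace (subtopology (Euclidean_space m) W). ?p x \<in> ball (?p c) \<epsilon>}"
      by (rule openin_continuous_map_preimage[OF cont]) simp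
    then have "openin (Euclidean_space m) {x \<in> topspace (subtopology (Euclidean_space m) W). ?p x \<in> ball (?p c) \<epsilon>}"
      using W openin_trans_full by blast
    moreover have "c \<in> {x \<in> topspace (subtopology (Euclidean_space m) W). ?p x \<in> ball (?p c) \<epsilon>}"
      using c cW \<open>0 < \<epsilon>\<close> by simp
    ultimately show ?thesis
      unfolding eventually_nhdsin
      by (intro disjI2 exI[of _ "{x \<in> topspace (subtopology (Euclidean_space m) W). ?p x \<in> ball (?p c) \<epsilon>}"]
          conjI ballI) (auto simp: dist_real_def abs_minus_commute)
  qed
  have "\<forall>\<^sub>F x in nhdsin (Euclidean_space m) c. x \<in> W"
    using W c by (auto simp: eventually_nhdsin)
  moreover have "\<forall>\<^sub>F x in nhdsin (Euclidean_space m) c. \<forall>i\<in>{..<m}. \<forall>j\<in>{..<n}.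
      \<bar>partial_deriv i (\<lambda>y. f y j) x - partial_deriv i (\<lambda>y. f y j) c\<bar> \<le> \<epsilon>"
    by (intro eventually_ball_finite ballI ev) auto
  ultimately have "\<forall>\<^sub>F x in nhdsin (Euclidean_space m) c. x \<in> W \<and> (\<forall>i\<in>{..<m}. \<forall>j\<in>{..<n}.
      \<bar>partial_deriv i (\<lambda>y. f y j) x - partial_deriv i (\<lambda>y. f y j) c\<bar> \<le> \<epsilon>)"
    by (rule eventually_conj)
  from eventually_nhdsin_cube[OF this cW] obtain r where
    "0 < r" "\<And>x. x \<in> cube m c r \<Longrightarrow> x \<in> W \<and> (\<forall>i\<in>{..<m}. \<forall>j\<in>{..<n}.
      \<bar>partial_deriv i (\<lambda>y. f y j) x - partial_deriv i (\<lambda>y. f y j) c\<bar> \<le> \<epsilon>)"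
    by metis
  then show ?thesis by (intro that[of r]) auto
qed

text \<open>
  Changing one coordinate at a time, each change is controlled by the mean value theorem in one variable.
\<close>

lemma increment_nearly_linear:
  fixes f :: "(nat \<Rightarrow> real) \<Rightarrow> real"
  assumes diff: "\<And>x i. x \<in> cube m c r \<Longrightarrow> i < m \<Longrightarrow> (\<lambda>s. f (x(i := s))) field_differentiable (at (x i))"
    and near: "\<And>x i. x \<in> cube m c r \<Longrightarrow> i < m \<Longrightarrow> \<bar>partial_deriv i f x - a i\<bar> \<le> \<epsilon>"
    and y: "y \<in> cube m c r" "y' \<in> cube m c r"
  shows "\<bar>f y' - f y - (\<Sum>i<m. a i * (y' i - y i))\<bar> \<le> \<epsilon> * (\<Sum>i<m. \<bar>y' i - y i\<bar>)"
proof -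
  \<comment> \<open>The polygon from \<open>y\<close> to \<open>y'\<close> along the coordinate axes; its corners stay in the cube.\<close>
  define x where "x k = (\<lambda>i. if i < k then y' i else y i)" for k
  have x_cube: "(x k)(i := s) \<in> cube m c r" if "i < m" "\<bar>s - c i\<bar> \<le> r" for k i s
    using y that by (auto simp: x_def cube_def topspace_Euclidean_space)
  have step: "\<bar>f (x (Suc k)) - f (x k) - a k * (y' k - y k)\<bar> \<le> \<epsilon> * \<bar>y' k - y k\<bar>" if k: "k < m" for k
  proof -
    define g where "g s = f ((x k)(k := s)) - a k * s" for s
    have der: "(g has_real_derivative (partial_deriv k f ((x k)(k := s)) - a k)) (at s within cball (c k) r)"
      and bound: "norm (partial_deriv k f ((x k)(k := s)) - a k) \<le> \<epsilon>"
      if "s \<in> cball (c k) r" for s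
    proof -
      have c: "(x k)(k := s) \<in> cube m c r"
        using that by (intro x_cube k) (auto simp: dist_real_def abs_minus_commute)
      from diff[OF c k] have "((\<lambda>s. f ((x k)(k := s))) has_real_derivative partial_deriv k f ((x k)(k := s))) (at s)"
        by (simp add: field_differentiable_derivI partial_deriv_def flip: DERIV_deriv_iff_field_differentiable)
      then show "(g has_real_derivative (partial_deriv k f ((x k)(k := s)) - a k)) (at s within cball (c k) r)"
        unfolding g_def by (auto intro!: derivative_eq_intros elim: has_field_derivative_at_within)
      show "norm (partial_deriv k f ((x k)(k := s)) - a k) \<le> \<epsilon>" using near[OF c k] by simp
    qed
    have "norm (g (y' k) - g (y k)) \<le> \<epsilon> * norm (y' k - y k)"
      by (rule field_differentiable_bound[OF convex_cball der bound])
         (use y k in \<open>auto simp: cube_def dist_real_def abs_minus_commute\<close>)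
    moreover have "(x k)(k := y' k) = x (Suc k)" "(x k)(k := y k) = x k"
      by (auto simp: x_def fun_eq_iff)
    ultimately show ?thesis by (simp add: g_def algebra_simps)
  qed
  have "x 0 = y" "x m = y'"
    using y by (auto simp: x_def fun_eq_iff cube_def topspace_Euclidean_space)
  then have "f y' - f y = (\<Sum>k<m. f (x (Suc k)) - f (x k))"
    using sum_lessThan_telescope[of "\<lambda>k. f (x k)" m] by simp
  then have "f y' - f y - (\<Sum>i<m. a i * (y' i - y i))
      = (\<Sum>k<m. f (x (Suc k)) - f (x k) - a k * (y' k - y k))"
    by (simp add: sum_subtractf)
  also have "\<bar>\<dots>\<bar> \<le> (\<Sum>k<m. \<epsilon> * \<bar>y' k - y k\<bar>)"
    using step by (intro order_trans[OF sum_abs] sum_mono) auto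
  finally show ?thesis by (simp add: sum_distrib_left)
qed

text \<open>
  Continuity of the partial derivatives makes increments of \<open>f\<close> linear up to a small multiple of the
  increment of the argument, so the difference quotients of \<open>f\<close> along a curve converge.
\<close>

lemma C1_on_chain_rule:
  assumes f: "C1_on m n W f" and W: "openin (Euclidean_space m) W"
    and \<gamma>0: "\<gamma> t0 \<in> W" and \<gamma>: "\<forall>\<^sub>F t in at t0. \<gamma> t \<in> W"
    and \<gamma>': "\<And>i. i < m \<Longrightarrow> ((\<lambda>t. \<gamma> t i) has_real_derivative v i) (at t0)"
    and j: "j < n"
  shows "((\<lambda>t. f (\<gamma> t) j) has_real_derivative differential m f (\<gamma> t0) v j) (at t0)"
proof -
  let ?c = "\<gamma> t0"
  let ?a = "\<lambda>i. partial_deriv i (\<lambda>y. f y j) ?c"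
  let ?q = "\<lambda>i t. (\<gamma> t i - ?c i) / (t - t0)"
  let ?Q = "\<lambda>t. (f (\<gamma> t) j - f ?c j) / (t - t0)"
  have q: "(?q i \<longlongrightarrow> v i) (at t0)" if "i < m" for i
    using \<gamma>'[OF that] by (simp add: has_field_derivative_iff)
  have "((\<lambda>t. ?Q t - (\<Sum>i<m. ?a i * ?q i t)) \<longlongrightarrow> 0) (at t0)"
  proof (rule tendstoI)
    fix e :: real assume "0 < e"
    define G where "G = (\<Sum>i<m. \<bar>v i\<bar>) + 1"
    have G: "0 < G" by (simp add: G_def add_nonneg_pos sum_nonneg)
    obtain r where r: "0 < r" "cube m ?c r \<subseteq> W" and near:
      "\<And>x i j. x \<in> cube m ?c r \<Longrightarrow> i < m \<Longrightarrow> j < n \<Longrightarrow>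
       \<bar>partial_deriv i (\<lambda>y. f y j) x - partial_deriv i (\<lambda>y. f y j) ?c\<bar> \<le> e / (2 * G)"
      using C1_on_partials_nearly_constant[OF f W \<gamma>0, of "e / (2 * G)"] \<open>0 < e\<close> G
      by (metis zero_less_divide_iff mult_pos_pos zero_less_numeral)
    have "((\<lambda>t. \<Sum>i<m. \<bar>?q i t\<bar>) \<longlongrightarrow> (\<Sum>i<m. \<bar>v i\<bar>)) (at t0)"
      by (intro tendsto_intros q) auto
    then have ev1: "\<forall>\<^sub>F t in at t0. (\<Sum>i<m. \<bar>?q i t\<bar>) < G"
      by (rule order_tendstoD) (simp add: G_def)
    have "\<forall>\<^sub>F t in at t0. \<bar>\<gamma> t i - ?c i\<bar> \<le> r" if "i < m" for i
    proof -
      have "((\<lambda>t. \<gamma> t i) \<longlongrightarrow> ?c i) (at t0)"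
        using DERIV_isCont[OF \<gamma>'[OF that]] by (simp add: isCont_def)
      from tendstoD[OF this r(1)] show ?thesis
        by (rule eventually_mono) (simp add: dist_real_def)
    qed
    then have ev2: "\<forall>\<^sub>F t in at t0. \<forall>i\<in>{..<m}. \<bar>\<gamma> t i - ?c i\<bar> \<le> r"
      by (intro eventually_ball_finite) auto
    show "\<forall>\<^sub>F t in at t0. dist (?Q t - (\<Sum>i<m. ?a i * ?q i t)) 0 < e"
      using ev1 ev2 \<gamma> eventually_neq_at_within[of t0 t0 UNIV]
    proof eventually_elim
      case (elim t)
      have cubes: "\<gamma> t \<in> cube m ?c r" "?c \<in> cube m ?c r"
        using elim \<gamma>0 W openin_subset r(1) by (fastforce simp: cube_def)+
      have "\<bar>f (\<gamma> t) j - f ?c j - (\<Sum>i<m. ?a i * (\<gamma> t i - ?c i))\<bar> \<le> e / (2 * G) * (\<Sum>i<m. \<bar>\<gamma> t i - ?c i\<bar>)"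
        using f j r(2) near cubes
        by (intro increment_nearly_linear[of m ?c r "\<lambda>y. f y j"]) (auto simp: C1_on_def)
      then have "\<bar>f (\<gamma> t) j - f ?c j - (\<Sum>i<m. ?a i * (\<gamma> t i - ?c i))\<bar> / \<bar>t - t0\<bar>
          \<le> e / (2 * G) * (\<Sum>i<m. \<bar>\<gamma> t i - ?c i\<bar>) / \<bar>t - t0\<bar>"
        by (rule divide_right_mono) simp
      moreover have sum_q: "(\<Sum>i<m. ?a i * ?q i t) = (\<Sum>i<m. ?a i * (\<gamma> t i - ?c i)) / (t - t0)"
        by (simp add: sum_divide_distrib)
      have "?Q t - (\<Sum>i<m. ?a i * ?q i t)
          = (f (\<gamma> t) j - f ?c j - (\<Sum>i<m. ?a i * (\<gamma> t i - ?c i))) / (t - t0)"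
        unfolding sum_q by (rule diff_divide_distrib[symmetric])
      moreover have "(\<Sum>i<m. \<bar>?q i t\<bar>) = (\<Sum>i<m. \<bar>\<gamma> t i - ?c i\<bar>) / \<bar>t - t0\<bar>"
        by (simp add: sum_divide_distrib)
      ultimately have "\<bar>?Q t - (\<Sum>i<m. ?a i * ?q i t)\<bar> \<le> e / (2 * G) * (\<Sum>i<m. \<bar>?q i t\<bar>)"
        by (simp add: abs_divide)
      also have "\<dots> \<le> e / (2 * G) * G"
        using elim(1) \<open>0 < e\<close> G by (intro mult_left_mono) auto
      also have "\<dots> < e" using \<open>0 < e\<close> G by simp
      finally show ?case by simp
    qed
  qed
  moreover have "((\<lambda>t. \<Sum>i<m. ?a i * ?q i t) \<longlongrightarrow> differential m f ?c v j) (at t0)"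
    unfolding differential_def by (intro tendsto_intros q) auto
  ultimately have "((\<lambda>t. (?Q t - (\<Sum>i<m. ?a i * ?q i t)) + (\<Sum>i<m. ?a i * ?q i t))
      \<longlongrightarrow> 0 + differential m f ?c v j) (at t0)"
    by (rule tendsto_add)
  then show ?thesis by (simp add: has_field_derivative_iff)
qed

text \<open>
  To first order at \<open>c\<close> both the increment of \<open>f\<close> and the derivative of \<open>f\<close> at the nearby point \<open>y\<close>,
  applied to \<open>y - c\<close>, equal the derivative at \<open>c\<close> applied to \<open>y - c\<close>. Their difference is thus small
  compared with \<open>y - c\<close>, and, the derivative at \<open>c\<close> being injective, small compared with the
  increment of \<open>f\<close>.
\<close>

lemma radial_remainder_small:
  assumes f: "C1_on m n W f" and W: "openin (Euclidean_space m) W" and c: "c \<in> W" "0 < \<epsilon>"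
    and inj: "\<And>v. v \<in> topspace (Euclidean_space m) \<Longrightarrow> (\<And>j. j < n \<Longrightarrow> differential m f c v j = 0) \<Longrightarrow> v = (\<lambda>_. 0)"
  obtains r where "0 < r" "cube m c r \<subseteq> W"
    "\<And>y. y \<in> cube m c r \<Longrightarrow> y \<noteq> c \<Longrightarrow>
       (\<Sum>j<n. \<bar>differential m f y (\<lambda>i. y i - c i) j - (f y j - f c j)\<bar>) < \<epsilon> * (\<Sum>j<n. \<bar>f y j - f c j\<bar>)"
proof -
  let ?a = "\<lambda>j i. partial_deriv i (\<lambda>y. f y j) c"
  obtain C where C: "0 < C" and below:
    "\<And>v. v \<in> topspace (Euclidean_space m) \<Longrightarrow> (\<Sum>i<m. \<bar>v i\<bar>) \<le> C * (\<Sum>j<n. \<bar>\<Sum>i<m. ?a j i * v i\<bar>)"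
    by (rule injective_bounded_below[of m n ?a]) (use inj in \<open>auto simp: differential_def\<close>)
  \<comment> \<open>The final comparison needs \<open>2 n \<eta> < \<epsilon> (1 / C - n \<eta>)\<close>.\<close>
  define \<eta> where "\<eta> = \<epsilon> / (C * (2 + \<epsilon>) * (real n + 1))"
  have "0 < \<eta>" using C \<open>0 < \<epsilon>\<close> by (simp add: \<eta>_def add_pos_pos)
  have cancel: "K * n * (\<epsilon> / (K * q)) = \<epsilon> * (n / q)" if "K \<noteq> 0" for K q :: real
    using that by simp
  have "C * (2 + \<epsilon>) \<noteq> 0" using C \<open>0 < \<epsilon>\<close> by simp
  then have "C * (2 + \<epsilon>) * n * \<eta> = \<epsilon> * (n / (real n + 1))"
    unfolding \<eta>_def by (rule cancel)
  also have "\<dots> < \<epsilon>" using \<open>0 < \<epsilon>\<close> by (simp add: pos_divide_less_eq add_nonneg_pos distrib_left)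
  finally have \<eta>_small: "C * (2 + \<epsilon>) * n * \<eta> < \<epsilon>" .
  obtain r where r: "0 < r" "cube m c r \<subseteq> W" and near:
    "\<And>x i j. x \<in> cube m c r \<Longrightarrow> i < m \<Longrightarrow> j < n \<Longrightarrow> \<bar>partial_deriv i (\<lambda>y. f y j) x - ?a j i\<bar> \<le> \<eta>"
    using C1_on_partials_nearly_constant[OF f W c(1) \<open>0 < \<eta>\<close>] by metis
  have "(\<Sum>j<n. \<bar>differential m f y (\<lambda>i. y i - c i) j - (f y j - f c j)\<bar>) < \<epsilon> * (\<Sum>j<n. \<bar>f y j - f c j\<bar>)"
    if y: "y \<in> cube m c r" "y \<noteq> c" for y
  proof -
    define v where "v i = y i - c i" for i
    define V where "V = (\<Sum>i<m. \<bar>v i\<bar>)"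
    define A where "A j = (\<Sum>i<m. ?a j i * v i)" for j
    have cE: "c \<in> topspace (Euclidean_space m)" using W c openin_subset by blast
    have c_cube: "c \<in> cube m c r" using cE r by (auto simp: cube_def)
    have v: "v \<in> topspace (Euclidean_space m)"
      using y cE by (auto simp: v_def cube_def topspace_Euclidean_space)
    have "0 < V"
    proof -
      obtain i where "y i \<noteq> c i" using y(2) by auto
      moreover have "i < m"
      proof (rule ccontr)
        assume "\<not> i < m"
        then show False using \<open>y i \<noteq> c i\<close> y cE by (auto simp: cube_def topspace_Euclidean_space)
      qed
      ultimately show ?thesis
        unfolding V_def by (intro sum_pos2[of _ i]) (auto simp: v_def)
    qed
    have d1: "\<bar>f y j - f c j - A j\<bar> \<le> \<eta> * V" if "j < n" for j
      unfolding A_def V_def v_def using f that r(2) near y c_cube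
      by (intro increment_nearly_linear[of m c r "\<lambda>y. f y j"]) (auto simp: C1_on_def)
    have d2: "\<bar>differential m f y v j - A j\<bar> \<le> \<eta> * V" if "j < n" for j
    proof -
      have "differential m f y v j - A j = (\<Sum>i<m. (partial_deriv i (\<lambda>y. f y j) y - ?a j i) * v i)"
        by (simp add: differential_def A_def left_diff_distrib sum_subtractf)
      also have "\<bar>\<dots>\<bar> \<le> (\<Sum>i<m. \<eta> * \<bar>v i\<bar>)"
        using near[OF y(1) _ that]
        by (intro order_trans[OF sum_abs] sum_mono) (simp add: abs_mult mult_right_mono)
      finally show ?thesis by (simp add: V_def sum_distrib_left)
    qed
    have "(\<Sum>j<n. \<bar>differential m f y v j - (f y j - f c j)\<bar>) \<le> (\<Sum>j<n. 2 * (\<eta> * V))"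
    proof (rule sum_mono)
      fix j assume "j \<in> {..<n}"
      then show "\<bar>differential m f y v j - (f y j - f c j)\<bar> \<le> 2 * (\<eta> * V)"
        using d1[of j] d2[of j] by simp
    qed
    then have e: "(\<Sum>j<n. \<bar>differential m f y v j - (f y j - f c j)\<bar>) \<le> 2 * n * \<eta> * V"
      by simp
    have "(\<Sum>j<n. \<bar>A j\<bar>) \<le> (\<Sum>j<n. \<bar>f y j - f c j\<bar> + \<eta> * V)"
    proof (rule sum_mono)
      fix j assume "j \<in> {..<n}"
      then show "\<bar>A j\<bar> \<le> \<bar>f y j - f c j\<bar> + \<eta> * V" using d1[of j] by simp
    qed
    then have "(\<Sum>j<n. \<bar>A j\<bar>) \<le> (\<Sum>j<n. \<bar>f y j - f c j\<bar>) + n * \<eta> * V"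
      by (simp add: sum.distrib)
    then have "V \<le> C * ((\<Sum>j<n. \<bar>f y j - f c j\<bar>) + n * \<eta> * V)"
      using below[OF v] C unfolding V_def A_def
      by (meson mult_left_mono less_imp_le order_trans)
    then have "\<epsilon> * V \<le> \<epsilon> * (C * ((\<Sum>j<n. \<bar>f y j - f c j\<bar>) + n * \<eta> * V))"
      using \<open>0 < \<epsilon>\<close> by (intro mult_left_mono) auto
    then have "\<epsilon> * V \<le> C * (\<epsilon> * (\<Sum>j<n. \<bar>f y j - f c j\<bar>)) + C * \<epsilon> * n * \<eta> * V"
      by (simp add: algebra_simps)
    moreover have "C * (2 + \<epsilon>) * n * \<eta> * V < \<epsilon> * V"
      using \<eta>_small \<open>0 < V\<close> by simp
    ultimately have "C * (2 * n * \<eta> * V) < C * (\<epsilon> * (\<Sum>j<n. \<bar>f y j - f c j\<bar>))"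
      by (simp add: algebra_simps)
    then have "2 * n * \<eta> * V < \<epsilon> * (\<Sum>j<n. \<bar>f y j - f c j\<bar>)"
      using C by simp
    with e show ?thesis by (simp add: v_def[abs_def])
  qed
  with r show ?thesis by (rule that)
qed

section \<open>Flows that become linear under an embedding\<close>

text \<open>
  The matrix \<open>E t\<close> plays the role of \<open>e\<^sup>t\<^sup>B\<close>; on the image of \<open>F\<close> its group law is that of
  the flow.
\<close>

locale linearized_flow =
  fixes X :: "'a topology" and A :: "'a chart set" and d n :: nat
    and \<Phi> :: "real \<Rightarrow> 'a \<Rightarrow> 'a" and F :: "'a \<Rightarrow> nat \<Rightarrow> real"
    and E :: "real \<Rightarrow> nat \<Rightarrow> nat \<Rightarrow> real"
  assumes manifold: "C1_manifold d X A"
    and compact: "compact_space X"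
    and C1_flow: "C1_flow d X A \<Phi>"
    and embedding: "C1_embedding d X A n (Euclidean_space n) (Euclidean_atlas n) F"
    and linear: "\<And>t x k. x \<in> topspace X \<Longrightarrow> k < n \<Longrightarrow> F (\<Phi> t x) k = (\<Sum>j<n. E t k j * F x j)"
begin

lemma chart_facts:
  assumes "(U, \<phi>) \<in> A"
  shows "openin X U" "openin (Euclidean_space d) (\<phi> ` U)" "inj_on \<phi> U"
    "homeomorphic_map (subtopology X U) (subtopology (Euclidean_space d) (\<phi> ` U)) \<phi>"
    "U \<subseteq> topspace X" "x \<in> U \<Longrightarrow> \<phi> x \<in> topspace (Euclidean_space d)"
    "x \<in> U \<Longrightarrow> inv_into U \<phi> (\<phi> x) = x"
proof -
  have c: "chart_on d X (U, \<phi>)" using manifold assms by (auto simp: C1_manifold_def C1_atlas_def)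
  then show 1: "openin X U" "openin (Euclidean_space d) (\<phi> ` U)"
    and 2: "homeomorphic_map (subtopology X U) (subtopology (Euclidean_space d) (\<phi> ` U)) \<phi>"
    by (auto simp: chart_on_def)
  show 3: "U \<subseteq> topspace X" using 1 openin_subset by blast
  then show "inj_on \<phi> U"
    using homeomorphic_imp_injective_map[OF 2] by (simp add: Int_absorb1)
  then show "x \<in> U \<Longrightarrow> inv_into U \<phi> (\<phi> x) = x" by simp
  show "x \<in> U \<Longrightarrow> \<phi> x \<in> topspace (Euclidean_space d)"
    using openin_subset[OF 1(2)] by blast
qed

lemma flow_facts:
  assumes "x \<in> topspace X"
  shows "\<Phi> t x \<in> topspace X" "\<Phi> 0 x = x" "\<Phi> (s + t) x = \<Phi> s (\<Phi> t x)"
  using C1_flow assms by (auto simp: C1_flow_def flow_def)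

lemma eventually_in_chart:
  assumes "(U, \<phi>) \<in> A" "x \<in> U"
  shows "\<forall>\<^sub>F t in nhds 0. \<Phi> t x \<in> U"
proof -
  have x: "x \<in> topspace X" using assms chart_facts(5) by blast
  have "continuous_map (prod_topology euclideanreal X) X (\<lambda>(t, x). \<Phi> t x)"
    using C1_flow by (simp add: C1_flow_def C1_map_def)
  moreover have "continuous_map euclideanreal (prod_topology euclideanreal X) (\<lambda>t. (t, x))"
    using x by (intro continuous_map_pairedI) auto
  ultimately have "continuous_map euclideanreal X (\<lambda>t. \<Phi> t x)"
    using continuous_map_compose[of euclideanreal "prod_topology euclideanreal X" "\<lambda>t. (t, x)" X]
    by (fastforce simp: o_def)
  from openin_continuous_map_preimage[OF this chart_facts(1)[OF assms(1)]]
  have "open {t. \<Phi> t x \<in> U}" by simp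
  then show ?thesis
    using eventually_nhds_in_open[of "{t. \<Phi> t x \<in> U}" 0] flow_facts(2)[OF x] assms(2) by simp
qed

text \<open>
  In the product chart \<open>cc\<close> the flow becomes the map \<open>G\<close>, whose coordinate \<open>0\<close> is time. The
  partial derivative of \<open>G\<close> in that coordinate is the source of both existence and continuity of the
  generating vector field in the chart \<open>\<phi>\<close>.
\<close>

lemma flow_in_chart:
  assumes "(U, \<phi>) \<in> A"
  defines "cc \<equiv> \<lambda>(t::real, x). case_nat t (\<phi> x)"
  defines "G \<equiv> \<phi> \<circ> (\<lambda>(t, x). \<Phi> t x) \<circ> inv_into (UNIV \<times> U) cc"
  defines "W \<equiv> cc ` ((UNIV \<times> U) \<inter> (\<lambda>(t, x). \<Phi> t x) -` U)"
  shows "C1_on (Suc d) d W G" "x \<in> U \<Longrightarrow> case_nat 0 (\<phi> x) \<in> W"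
    "x \<in> U \<Longrightarrow> G (case_nat t (\<phi> x)) = \<phi> (\<Phi> t x)"
proof -
  have "(UNIV \<times> U, cc) \<in> real_times_atlas A"
    using assms(1) unfolding real_times_atlas_def cc_def by force
  then show "C1_on (Suc d) d W G"
    using C1_flow assms(1) unfolding C1_flow_def C1_map_def W_def G_def by fast
  show "case_nat 0 (\<phi> x) \<in> W" if "x \<in> U"
    using that flow_facts(2)[of x] chart_facts(5)[OF assms(1)]
    by (auto simp: W_def cc_def intro!: rev_image_eqI[of "(0, x)"])
  have "inj_on cc (UNIV \<times> U)"
  proof (rule inj_onI)
    fix z z' assume z: "z \<in> UNIV \<times> U" "z' \<in> UNIV \<times> U" and eq: "cc z = cc z'"
    obtain t x t' x' where [simp]: "z = (t, x)" "z' = (t', x')" by (metis surj_pair)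
    have "t = t'" using fun_cong[OF eq, of 0] by (simp add: cc_def)
    moreover have "\<phi> x = \<phi> x'" 
      using fun_cong[OF eq, of "Suc _"] by (auto simp: cc_def fun_eq_iff)
    ultimately show "z = z'" using chart_facts(3)[OF assms(1)] z by (auto dest: inj_onD)
  qed
  then show "G (case_nat t (\<phi> x)) = \<phi> (\<Phi> t x)" if "x \<in> U"
    using inv_into_f_f[of cc "UNIV \<times> U" "(t, x)"] that by (simp add: G_def cc_def)
qed

lemma case_nat_upd_0: "(case_nat s y)(0 := t) = case_nat t y"
  by (auto simp: fun_eq_iff split: nat.split)

lemma higher_coordinates_stationary:
  assumes U: "(U, \<phi>) \<in> A" and x: "x \<in> U" and i: "d \<le> i"
  shows "((\<lambda>t. \<phi> (\<Phi> t x) i) has_real_derivative 0) (at 0)"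
proof -
  have "\<forall>\<^sub>F t in nhds 0. \<phi> (\<Phi> t x) i = 0"
    using eventually_in_chart[OF U x]
    by (rule eventually_mono) (use chart_facts(6)[OF U] i in \<open>auto simp: topspace_Euclidean_space\<close>)
  then show ?thesis by (subst DERIV_cong_ev[OF refl _ refl]) auto
qed

lemma has_derivative_in_chart:
  assumes U: "(U, \<phi>) \<in> A" and x: "x \<in> U"
  shows "((\<lambda>t. \<phi> (\<Phi> t x) i) has_real_derivative generating_vfield \<Phi> (U, \<phi>) x i) (at 0)"
proof (cases "i < d")
  case True
  define cc where "cc = (\<lambda>(t::real, x). case_nat t (\<phi> x))"
  define G where "G = \<phi> \<circ> (\<lambda>(t, x). \<Phi> t x) \<circ> inv_into (UNIV \<times> U) cc"
  define W where "W = cc ` ((UNIV \<times> U) \<inter> (\<lambda>(t, x). \<Phi> t x) -` U)"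
  note fc = flow_in_chart[OF U, folded cc_def, folded G_def W_def]
  have "(\<lambda>s. G ((case_nat 0 (\<phi> x))(0 := s)) i) field_differentiable (at (case_nat 0 (\<phi> x) 0))"
    using fc(1) fc(2)[OF x] True unfolding C1_on_def by blast
  then have "(\<lambda>t. \<phi> (\<Phi> t x) i) field_differentiable (at 0)"
    by (simp add: case_nat_upd_0 fc(3)[OF x])
  then show ?thesis by (simp add: generating_vfield_def DERIV_deriv_iff_field_differentiable)
next
  case False
  then have "((\<lambda>t. \<phi> (\<Phi> t x) i) has_real_derivative 0) (at 0)"
    by (intro higher_coordinates_stationary[OF U x]) simp
  then show ?thesis by (simp add: generating_vfield_def DERIV_imp_deriv)
qed

lemma vfield_in_Euclidean_space:
  assumes U: "(U, \<phi>) \<in> A" and x: "x \<in> U"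
  shows "generating_vfield \<Phi> (U, \<phi>) x \<in> topspace (Euclidean_space d)"
  using higher_coordinates_stationary[OF assms]
  by (auto simp: topspace_Euclidean_space generating_vfield_def DERIV_imp_deriv)

lemma continuous_vfield:
  assumes U: "(U, \<phi>) \<in> A"
  shows "continuous_map (subtopology (Euclidean_space d) (\<phi> ` U)) euclideanreal
           (\<lambda>y. generating_vfield \<Phi> (U, \<phi>) (inv_into U \<phi> y) i)"
    (is "continuous_map ?Y _ _")
proof (cases "i < d")
  case True
  define cc where "cc = (\<lambda>(t::real, x). case_nat t (\<phi> x))"
  define G where "G = \<phi> \<circ> (\<lambda>(t, x). \<Phi> t x) \<circ> inv_into (UNIV \<times> U) cc"
  define W where "W = cc ` ((UNIV \<times> U) \<inter> (\<lambda>(t, x). \<Phi> t x) -` U)"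
  note fc = flow_in_chart[OF U, folded cc_def, folded G_def W_def]
  have "continuous_map ?Y (subtopology (Euclidean_space (Suc d)) W) (\<lambda>y. case_nat 0 y)"
  proof -
    have "continuous_map ?Y euclideanreal (\<lambda>y. case_nat 0 y k)" for k
      by (cases k) (auto simp: Euclidean_space_def intro!: continuous_map_from_subtopology continuous_map_product_projection)
    then show ?thesis
      using fc(2)
      by (auto simp: continuous_map_in_subtopology Euclidean_space_def continuous_map_componentwise_UNIV
            topspace_Euclidean_space split: nat.split)
  qed
  moreover have "continuous_map (subtopology (Euclidean_space (Suc d)) W) euclideanreal (partial_deriv 0 (\<lambda>y. G y i))"
    using fc(1) True by (auto simp: C1_on_def)
  ultimately have "continuous_map ?Y euclideanreal (\<lambda>y. partial_deriv 0 (\<lambda>y. G y i) (case_nat 0 y))"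
    by (rule continuous_map_compose[unfolded o_def])
  moreover have "partial_deriv 0 (\<lambda>y. G y i) (case_nat 0 y) = generating_vfield \<Phi> (U, \<phi>) (inv_into U \<phi> y) i"
    if "y \<in> topspace ?Y" for y
    using that chart_facts(7)[OF U] fc(3)
    by (auto simp: partial_deriv_def generating_vfield_def case_nat_upd_0)
  ultimately show ?thesis by (rule continuous_map_eq)
next
  case False
  have zero: "0 = generating_vfield \<Phi> (U, \<phi>) (inv_into U \<phi> y) i" if "y \<in> topspace ?Y" for y
    using vfield_in_Euclidean_space[OF U, of "inv_into U \<phi> y"] that False
    by (auto simp: topspace_Euclidean_space inv_into_into)
  show ?thesis by (rule continuous_map_eq[of ?Y euclideanreal "\<lambda>_. 0", OF _ zero]) simp_all
qed

lemma embedding_in_chart: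
  assumes U: "(U, \<phi>) \<in> A"
  shows "C1_on d n (\<phi> ` U) (F \<circ> inv_into U \<phi>)"
    "x \<in> U \<Longrightarrow> v \<in> topspace (Euclidean_space d) \<Longrightarrow>
      (\<And>j. j < n \<Longrightarrow> differential d (F \<circ> inv_into U \<phi>) (\<phi> x) v j = 0) \<Longrightarrow> v = (\<lambda>_. 0)"
proof -
  have im: "F ` topspace X \<subseteq> topspace (Euclidean_space n)"
    using embedding by (auto simp: C1_embedding_def C1_map_def continuous_map_def)
  then have "U \<inter> F -` topspace (Euclidean_space n) = U"
    using chart_facts(5)[OF U] by auto
  moreover have "\<forall>c\<in>A. (\<lambda>(U, \<phi>). C1_on d n (\<phi> ` (U \<inter> F -` topspace (Euclidean_space n)))
      ((\<lambda>x. x) \<circ> F \<circ> inv_into U \<phi>)) c"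
    using embedding by (simp add: C1_embedding_def C1_map_def Euclidean_atlas_def)
  ultimately show "C1_on d n (\<phi> ` U) (F \<circ> inv_into U \<phi>)"
    using U by (fastforce simp: o_def)
  have "\<forall>c\<in>A. (\<lambda>(U, \<phi>). \<forall>x\<in>U \<inter> F -` topspace (Euclidean_space n). \<forall>v\<in>topspace (Euclidean_space d).
      (\<forall>j<n. differential d ((\<lambda>x. x) \<circ> F \<circ> inv_into U \<phi>) (\<phi> x) v j = 0) \<longrightarrow> v = (\<lambda>_. 0)) c"
    using embedding by (simp add: C1_embedding_def immersion_def Euclidean_atlas_def)
  from bspec[OF this U] have imm: "\<forall>x\<in>U \<inter> F -` topspace (Euclidean_space n). \<forall>v\<in>topspace (Euclidean_space d).
      (\<forall>j<n. differential d (F \<circ> inv_into U \<phi>) (\<phi> x) v j = 0) \<longrightarrow> v = (\<lambda>_. 0)"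
    by (simp add: o_def)
  show "v = (\<lambda>_. 0)"
    if "x \<in> U" "v \<in> topspace (Euclidean_space d)"
      "\<And>j. j < n \<Longrightarrow> differential d (F \<circ> inv_into U \<phi>) (\<phi> x) v j = 0"
    by (rule imm[rule_format, of x]) (use that im chart_facts(5)[OF U] in auto)
qed

definition velocity :: "'a \<Rightarrow> nat \<Rightarrow> real" where
  "velocity x j = deriv (\<lambda>t. F (\<Phi> t x) j) 0"

lemma velocity_in_chart:
  assumes U: "(U, \<phi>) \<in> A" and x: "x \<in> U" and j: "j < n"
  shows "((\<lambda>t. F (\<Phi> t x) j) has_real_derivative velocity x j) (at 0)"
    "velocity x j = differential d (F \<circ> inv_into U \<phi>) (\<phi> x) (generating_vfield \<Phi> (U, \<phi>) x) j"
proof -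
  let ?f = "F \<circ> inv_into U \<phi>"
  have x0: "\<Phi> 0 x = x" using flow_facts(2) chart_facts(5)[OF U] x by blast
  have ev: "\<forall>\<^sub>F t in at 0. \<phi> (\<Phi> t x) \<in> \<phi> ` U"
    using eventually_in_chart[OF U x] by (auto simp: eventually_at_filter elim: eventually_mono)
  have "((\<lambda>t. ?f (\<phi> (\<Phi> t x)) j) has_real_derivative
      differential d ?f (\<phi> (\<Phi> 0 x)) (generating_vfield \<Phi> (U, \<phi>) x) j) (at 0)"
    using x by (intro C1_on_chain_rule[OF embedding_in_chart(1)[OF U] chart_facts(2)[OF U] _ ev _ j]
        has_derivative_in_chart[OF U x]) (simp add: x0)
  moreover have "\<forall>\<^sub>F t in nhds 0. ?f (\<phi> (\<Phi> t x)) j = F (\<Phi> t x) j"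
    using eventually_in_chart[OF U x] by (rule eventually_mono) (simp add: chart_facts(7)[OF U])
  ultimately have "((\<lambda>t. F (\<Phi> t x) j) has_real_derivative
      differential d ?f (\<phi> x) (generating_vfield \<Phi> (U, \<phi>) x) j) (at 0)"
    unfolding x0 by (subst (asm) DERIV_cong_ev[OF refl _ refl]) auto
  then show "((\<lambda>t. F (\<Phi> t x) j) has_real_derivative velocity x j) (at 0)"
    "velocity x j = differential d ?f (\<phi> x) (generating_vfield \<Phi> (U, \<phi>) x) j"
    by (simp_all add: velocity_def DERIV_imp_deriv)
qed

lemma in_some_chart:
  assumes "x \<in> topspace X"
  obtains U \<phi> where "(U, \<phi>) \<in> A" "x \<in> U"
  using manifold assms unfolding C1_manifold_def C1_atlas_def by blast

text \<open>
  By linearity the velocity at time \<open>s\<close> is the matrix \<open>E s\<close> applied to the velocity at time \<open>0\<close>.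
\<close>

lemma orbit_derivative:
  assumes x: "x \<in> topspace X" and k: "k < n"
  shows "((\<lambda>s. F (\<Phi> s x) k) has_real_derivative (\<Sum>j<n. E s k j * velocity x j)) (at s)"
proof -
  obtain U \<phi> where U: "(U, \<phi>) \<in> A" "x \<in> U" using in_some_chart[OF x] .
  have "((\<lambda>t. \<Sum>j<n. E s k j * F (\<Phi> t x) j) has_real_derivative (\<Sum>j<n. E s k j * velocity x j)) (at 0)"
    by (intro DERIV_sum DERIV_cmult velocity_in_chart(1)[OF U]) auto
  moreover have "(\<Sum>j<n. E s k j * F (\<Phi> t x) j) = F (\<Phi> (t + s) x) k" for t
    using linear[OF flow_facts(1)[OF x, of t] k, of s] flow_facts(3)[OF x, of s t] by (simp add: add.commute)
  ultimately show ?thesis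
    using DERIV_shift[of "\<lambda>s. F (\<Phi> s x) k" _ 0 s] by simp
qed

text \<open>
  If the velocity vanishes at time \<open>0\<close>, it vanishes at all times, and \<open>F\<close> is injective.
\<close>

lemma equilibrium_if_vfield_0:
  assumes U: "(U, \<phi>) \<in> A" and x: "x \<in> U" and zero: "\<And>i. i < d \<Longrightarrow> generating_vfield \<Phi> (U, \<phi>) x i = 0"
  shows "x \<in> equilibria X \<Phi>"
proof -
  have xX: "x \<in> topspace X" using chart_facts(5)[OF U] x by blast
  have "velocity x j = 0" if "j < n" for j
    using velocity_in_chart(2)[OF U x that] zero by (simp add: differential_def)
  then have "((\<lambda>s. F (\<Phi> s x) k) has_real_derivative 0) (at s)" if "k < n" for k s
    using orbit_derivative[OF xX that, of s] by simp
  then have "F (\<Phi> s x) k = F (\<Phi> 0 x) k" if "k < n" for k s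
    using DERIV_isconst_all[of "\<lambda>s. F (\<Phi> s x) k" s 0] that by blast
  moreover have F: "continuous_map X (Euclidean_space n) F" "inj_on F (topspace X)"
    using embedding by (auto simp: C1_embedding_def C1_map_def embedding_map_def
        dest: homeomorphic_imp_injective_map)
  moreover have "F z k = 0" if "z \<in> topspace X" "\<not> k < n" for z k
    using F(1) that by (auto simp: continuous_map_def topspace_Euclidean_space Pi_iff)
  ultimately have "F (\<Phi> s x) = F x" for s
    using flow_facts(1,2)[OF xX] xX by (metis ext)
  then have "\<Phi> s x = x" for s
    using F(2) flow_facts(1)[OF xX] xX by (auto dest: inj_onD)
  then show ?thesis using xX by (simp add: equilibria_def)
qed

lemma embedding_bounded:
  obtains K where "\<And>x k. x \<in> topspace X \<Longrightarrow> k < n \<Longrightarrow> \<bar>F x k\<bar> \<le> K"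
proof -
  have "\<exists>K. \<forall>x\<in>topspace X. \<bar>F x k\<bar> \<le> K" for k
  proof -
    have "continuous_map X euclideanreal (\<lambda>x. F x k)"
      using embedding by (auto simp: C1_embedding_def C1_map_def Euclidean_space_def
          continuous_map_in_subtopology continuous_map_componentwise_UNIV)
    then have "compactin euclideanreal ((\<lambda>x. F x k) ` topspace X)"
      using compact image_compactin compact_space_def by blast
    then have "bounded ((\<lambda>x. F x k) ` topspace X)" by (simp add: compact_imp_bounded)
    then show ?thesis by (auto simp: bounded_iff)
  qed
  then obtain K where K: "\<And>x k. x \<in> topspace X \<Longrightarrow> \<bar>F x k\<bar> \<le> K k" by metis
  show ?thesis
  proof (rule that[of "\<Sum>k<n. \<bar>K k\<bar>"])
    fix x k assume "x \<in> topspace X" "k < n"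
    then have "\<bar>F x k\<bar> \<le> \<bar>K k\<bar>" using K[of x k] by linarith
    also have "\<dots> \<le> (\<Sum>k<n. \<bar>K k\<bar>)" using \<open>k < n\<close> by (intro member_le_sum) auto
    finally show "\<bar>F x k\<bar> \<le> (\<Sum>k<n. \<bar>K k\<bar>)" .
  qed
qed

text \<open>
  The heart of the argument. If the field at \<open>y\<close> were \<open>a\<close> times the radial vector \<open>y - \<phi> p\<close> with
  \<open>a \<noteq> 0\<close>, the orbit of \<open>h x = F x - F p\<close> would be, up to the small error \<open>e\<close>, a solution of
  \<open>u' = a u\<close>, and would grow exponentially in one of the two time directions. The bound on the orbits is
  uniform relative to the norm of the starting vector, so the error cannot prevent this however close
  \<open>y\<close> is to \<open>\<phi> p\<close> and however small \<open>a\<close> is.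
\<close>

lemma vfield_not_radial:
  assumes p: "p \<in> equilibria X \<Phi>" and U: "(U, \<phi>) \<in> A" and pU: "p \<in> U"
  shows "\<exists>r>0. \<forall>y \<in> cube d (\<phi> p) r. \<forall>a. y \<noteq> \<phi> p \<longrightarrow> a \<noteq> 0 \<longrightarrow>
       (\<exists>i<d. generating_vfield \<Phi> (U, \<phi>) (inv_into U \<phi> y) i \<noteq> a * (y i - \<phi> p i))"
proof -
  define h where "h x j = F x j - F p j" for x j
  have pX: "p \<in> topspace X" and p_fix: "\<Phi> t p = p" for t
    using p by (auto simp: equilibria_def)
  have h_linear: "(\<Sum>j<n. E t k j * h x j) = h (\<Phi> t x) k" if "x \<in> topspace X" "k < n" for t k x
    using linear[OF that, of t] linear[OF pX that(2), of t]
    by (simp add: h_def right_diff_distrib sum_subtractf p_fix)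
  obtain K where K: "\<And>x k. x \<in> topspace X \<Longrightarrow> k < n \<Longrightarrow> \<bar>F x k\<bar> \<le> K" using embedding_bounded by blast
  have h_bounded: "\<bar>h x k\<bar> \<le> 2 * K" if "x \<in> topspace X" "k < n" for x k
    using K[OF that] K[OF pX that(2)] unfolding h_def by linarith
  have bounded: "\<exists>K. \<forall>t. \<forall>k<n. \<bar>\<Sum>j<n. E t k j * z j\<bar> \<le> K" if "z \<in> h ` topspace X" for z
    using that h_linear h_bounded flow_facts(1) by (intro exI[of _ "2 * K"]) auto
  obtain I C b where I: "I \<subseteq> {..<n}" and C: "0 < C"
    and span: "\<And>z. z \<in> h ` topspace X \<Longrightarrow> coordinate_span n I b z"
    and uniform: "\<And>z t k. coordinate_span n I b z \<Longrightarrow> k < n \<Longrightarrow>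
       \<bar>\<Sum>j<n. E t k j * z j\<bar> \<le> C * (\<Sum>i<n. \<bar>z i\<bar>)"
    using orbits_uniformly_bounded[of "h ` topspace X" n E, OF bounded] by blast
  let ?f = "F \<circ> inv_into U \<phi>"
  \<comment> \<open>Small enough that \<open>n C \<epsilon> < 1\<close>.\<close>
  define \<epsilon> where "\<epsilon> = 1 / (C * (real n + 1))"
  have \<epsilon>: "0 < \<epsilon>" using C by (simp add: \<epsilon>_def add_nonneg_pos)
  have "\<phi> p \<in> \<phi> ` U" using pU by blast
  obtain r where r: "0 < r" "cube d (\<phi> p) r \<subseteq> \<phi> ` U"
    and remainder: "\<And>y. y \<in> cube d (\<phi> p) r \<Longrightarrow> y \<noteq> \<phi> p \<Longrightarrow>
       (\<Sum>j<n. \<bar>differential d ?f y (\<lambda>i. y i - \<phi> p i) j - (?f y j - ?f (\<phi> p) j)\<bar>)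
         < \<epsilon> * (\<Sum>j<n. \<bar>?f y j - ?f (\<phi> p) j\<bar>)"
    using radial_remainder_small[OF embedding_in_chart(1)[OF U] chart_facts(2)[OF U] \<open>\<phi> p \<in> \<phi> ` U\<close> \<epsilon>
        embedding_in_chart(2)[OF U pU]] by blast
  have "\<exists>i<d. generating_vfield \<Phi> (U, \<phi>) (inv_into U \<phi> y) i \<noteq> a * (y i - \<phi> p i)"
    if y: "y \<in> cube d (\<phi> p) r" "y \<noteq> \<phi> p" and a: "a \<noteq> 0" for y a
  proof (rule ccontr)
    define x where "x = inv_into U \<phi> y"
    assume "\<not> ?thesis"
    then have radial: "\<And>i. i < d \<Longrightarrow> generating_vfield \<Phi> (U, \<phi>) x i = a * (y i - \<phi> p i)"
      by (auto simp: x_def)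
    have x: "x \<in> U" "\<phi> x = y" using y r(2) by (auto simp: x_def inv_into_into f_inv_into_f)
    then have xX: "x \<in> topspace X" using chart_facts(5)[OF U] by blast
    define e where "e j = differential d ?f y (\<lambda>i. y i - \<phi> p i) j - h x j" for j
    have velocity: "velocity x j = a * (h x j + e j)" if "j < n" for j
      using velocity_in_chart(2)[OF U x(1) that] radial
      by (simp add: differential_def x e_def sum_distrib_left mult.left_commute)
    have small: "(\<Sum>j<n. \<bar>e j\<bar>) < \<epsilon> * (\<Sum>j<n. \<bar>h x j\<bar>)"
      using remainder[OF y] chart_facts(7)[OF U pU] by (simp add: e_def h_def x_def)
    \<comment> \<open>The velocity is a limit of difference quotients of vectors in the span, so it lies in the span.\<close>
    have e_span: "coordinate_span n I b e"
      unfolding coordinate_span_def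
    proof (intro allI impI)
      fix j assume j: "j < n"
      have vel: "((\<lambda>t. h (\<Phi> t x) i) has_real_derivative velocity x i) (at 0)" if "i < n" for i
        unfolding h_def using velocity_in_chart(1)[OF U x(1) that] by (auto intro!: derivative_eq_intros)
      have "((\<lambda>t. \<Sum>i\<in>I. h (\<Phi> t x) i * b i j) has_real_derivative (\<Sum>i\<in>I. velocity x i * b i j)) (at 0)"
        using I by (intro DERIV_sum DERIV_cmult_right vel) auto
      moreover have "(\<Sum>i\<in>I. h (\<Phi> t x) i * b i j) = h (\<Phi> t x) j" for t
        using span[of "h (\<Phi> t x)"] flow_facts(1)[OF xX] j by (simp add: coordinate_span_def)
      ultimately have "velocity x j = (\<Sum>i\<in>I. velocity x i * b i j)"
        using vel[OF j] DERIV_unique by fastforce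
      also have "\<dots> = (\<Sum>i\<in>I. a * (h x i * b i j + e i * b i j))"
        using I velocity by (intro sum.cong) (auto simp: algebra_simps)
      also have "\<dots> = a * ((\<Sum>i\<in>I. h x i * b i j) + (\<Sum>i\<in>I. e i * b i j))"
        by (simp add: sum_distrib_left sum.distrib distrib_left)
      also have "(\<Sum>i\<in>I. h x i * b i j) = h x j" using span[of "h x"] xX j by (simp add: coordinate_span_def)
      finally show "e j = (\<Sum>i\<in>I. e i * b i j)" using velocity[OF j] a by simp
    qed
    have "\<bar>h x k\<bar> \<le> C * (\<Sum>j<n. \<bar>e j\<bar>)" if k: "k < n" for k
    proof -
      have "((\<lambda>s. h (\<Phi> s x) k) has_real_derivative a * (h (\<Phi> s x) k + (\<Sum>j<n. E s k j * e j))) (at s)" for s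
      proof -
        have "((\<lambda>s. h (\<Phi> s x) k) has_real_derivative (\<Sum>j<n. E s k j * velocity x j)) (at s)"
          unfolding h_def using orbit_derivative[OF xX k, of s] by (auto intro!: derivative_eq_intros)
        also have "(\<Sum>j<n. E s k j * velocity x j) = (\<Sum>j<n. a * (E s k j * h x j + E s k j * e j))"
          using velocity by (intro sum.cong) (auto simp: algebra_simps)
        also have "\<dots> = a * (h (\<Phi> s x) k + (\<Sum>j<n. E s k j * e j))"
          by (simp add: h_linear[OF xX k, symmetric] sum_distrib_left sum.distrib distrib_left)
        finally show ?thesis .
      qed
      from bounded_solution_le_forcing[OF a this, of "2 * K" "C * (\<Sum>j<n. \<bar>e j\<bar>)" 0]
      show ?thesis
        using h_bounded[OF flow_facts(1)[OF xX] k] uniform[OF e_span k] flow_facts(2)[OF xX] by simp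
    qed
    then have "(\<Sum>k<n. \<bar>h x k\<bar>) \<le> (\<Sum>k<n. C * (\<Sum>j<n. \<bar>e j\<bar>))" by (intro sum_mono) auto
    also have "\<dots> = n * C * (\<Sum>j<n. \<bar>e j\<bar>)" by simp
    also have "\<dots> \<le> n * C * (\<epsilon> * (\<Sum>j<n. \<bar>h x j\<bar>))"
      using small C by (intro mult_left_mono) auto
    also have "\<dots> = n / (real n + 1) * (\<Sum>j<n. \<bar>h x j\<bar>)"
      using C by (simp add: \<epsilon>_def)
    finally have le: "(\<Sum>k<n. \<bar>h x k\<bar>) \<le> n / (real n + 1) * (\<Sum>j<n. \<bar>h x j\<bar>)" .
    have "0 \<le> (\<Sum>j<n. \<bar>e j\<bar>)" by (simp add: sum_nonneg)
    then have "0 < \<epsilon> * (\<Sum>j<n. \<bar>h x j\<bar>)" using small by linarith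
    then have "0 < (\<Sum>j<n. \<bar>h x j\<bar>)" using \<epsilon> by (rule zero_less_mult_pos)
    then have "n / (real n + 1) * (\<Sum>j<n. \<bar>h x j\<bar>) < 1 * (\<Sum>j<n. \<bar>h x j\<bar>)"
      by (intro mult_strict_right_mono) auto
    with le show False by simp
  qed
  with r(1) show ?thesis by (intro exI[of _ r] conjI ballI allI impI)
qed

section \<open>The index of isolated equilibria\<close>

lemma sphere_degree_equilibrium:
  assumes p: "p \<in> equilibria X \<Phi>" and U: "(U, \<phi>) \<in> A" and pU: "p \<in> U"
    and r: "0 < r" "closed_ball d (\<phi> p) r \<subseteq> \<phi> ` U"
    and nz: "\<forall>x\<in>U. x \<noteq> p \<and> \<phi> x \<in> closed_ball d (\<phi> p) r \<longrightarrow> (\<exists>i<d. generating_vfield \<Phi> (U, \<phi>) x i \<noteq> 0)"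
  shows "sphere_degree d (\<lambda>y. generating_vfield \<Phi> (U, \<phi>) (inv_into U \<phi> y)) (\<phi> p) r = 1 \<and> even d"
proof (cases "d = 0")
  case True
  then show ?thesis by (simp add: sphere_degree_def)
next
  case False
  obtain \<rho> where \<rho>: "0 < \<rho>" "\<forall>y \<in> cube d (\<phi> p) \<rho>. \<forall>a. y \<noteq> \<phi> p \<longrightarrow> a \<noteq> 0 \<longrightarrow>
       (\<exists>i<d. generating_vfield \<Phi> (U, \<phi>) (inv_into U \<phi> y) i \<noteq> a * (y i - \<phi> p i))"
    using vfield_not_radial[OF p U pU] by blast
  show ?thesis
  proof (rule sphere_degree_nowhere_radial[where \<epsilon> = "min r \<rho>"])
    show "continuous_map (subtopology (Euclidean_space d) (closed_ball d (\<phi> p) r)) euclideanreal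
        (\<lambda>y. generating_vfield \<Phi> (U, \<phi>) (inv_into U \<phi> y) i)" for i
      using continuous_map_from_subtopology_mono[OF continuous_vfield[OF U] r(2)] .
    show "generating_vfield \<Phi> (U, \<phi>) (inv_into U \<phi> y) \<in> topspace (Euclidean_space d)"
      if "y \<in> closed_ball d (\<phi> p) r" for y
      using vfield_in_Euclidean_space[OF U] that r(2) by (blast intro: inv_into_into)
    show "\<exists>i<d. generating_vfield \<Phi> (U, \<phi>) (inv_into U \<phi> y) i \<noteq> 0"
      if y: "y \<in> closed_ball d (\<phi> p) r" "y \<noteq> \<phi> p" for y
      using nz y r(2) by (metis f_inv_into_f inv_into_into subset_iff)
    show "\<exists>i<d. generating_vfield \<Phi> (U, \<phi>) (inv_into U \<phi> y) i \<noteq> a * (y i - \<phi> p i)"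
      if "y \<in> topspace (Euclidean_space d)" "enorm d (\<lambda>i. y i - \<phi> p i) = min r \<rho>" "a \<noteq> 0" for y a
    proof (rule \<rho>(2)[rule_format])
      show "y \<in> cube d (\<phi> p) \<rho>"
        using that abs_le_enorm[of _ d "\<lambda>i. y i - \<phi> p i"] by (force simp: cube_def)
      show "y \<noteq> \<phi> p" using that(2) r \<rho>(1) by (auto simp: enorm_def)
    qed (rule that)
  qed (use False chart_facts(6)[OF U pU] r \<rho>(1) in auto)
qed

lemma isolated_equilibrium_chart_ball:
  assumes p: "isolated_equilibrium X \<Phi> p"
  obtains U \<phi> r where "(U, \<phi>) \<in> A" "0 < r" "p \<in> U" "closed_ball d (\<phi> p) r \<subseteq> \<phi> ` U"
    "\<forall>x\<in>U. x \<noteq> p \<and> \<phi> x \<in> closed_ball d (\<phi> p) r \<longrightarrow> (\<exists>i<d. generating_vfield \<Phi> (U, \<phi>) x i \<noteq> 0)"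
proof -
  have pE: "p \<in> equilibria X \<Phi>" and pX: "p \<in> topspace X"
    using p by (auto simp: isolated_equilibrium_def equilibria_def)
  obtain T where T: "openin X T" "p \<in> T" "\<And>y. y \<in> T \<Longrightarrow> y \<in> equilibria X \<Phi> \<Longrightarrow> y = p"
    using p pX unfolding isolated_equilibrium_def in_derived_set_of by blast
  obtain U \<phi> where U: "(U, \<phi>) \<in> A" "p \<in> U" using in_some_chart[OF pX] .
  have "openin (subtopology X U) (U \<inter> T)" using T(1) openin_subtopology_Int2 by blast
  then have "openin (subtopology (Euclidean_space d) (\<phi> ` U)) (\<phi> ` (U \<inter> T))"
    using homeomorphic_imp_open_map[OF chart_facts(4)[OF U(1)]] by (simp add: open_map_def)
  then have "openin (Euclidean_space d) (\<phi> ` (U \<inter> T))"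
    using chart_facts(2)[OF U(1)] openin_trans_full by blast
  moreover have "\<phi> p \<in> \<phi> ` (U \<inter> T)" using U T by blast
  ultimately obtain r where r: "0 < r" "cube d (\<phi> p) r \<subseteq> \<phi> ` (U \<inter> T)"
    using openin_contains_cube by blast
  have "closed_ball d (\<phi> p) r \<subseteq> cube d (\<phi> p) r"
    by (auto simp: cube_def closed_ball_def intro: order_trans[OF abs_le_enorm])
  then have ball: "closed_ball d (\<phi> p) r \<subseteq> \<phi> ` (U \<inter> T)" using r(2) by blast
  show ?thesis
  proof (rule that[OF U(1) r(1) U(2)])
    show "closed_ball d (\<phi> p) r \<subseteq> \<phi> ` U" using ball by blast
    show "\<forall>x\<in>U. x \<noteq> p \<and> \<phi> x \<in> closed_ball d (\<phi> p) r \<longrightarrow> (\<exists>i<d. generating_vfield \<Phi> (U, \<phi>) x i \<noteq> 0)"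
    proof (intro ballI impI, rule ccontr)
      fix x assume x: "x \<in> U" "x \<noteq> p \<and> \<phi> x \<in> closed_ball d (\<phi> p) r"
        and "\<not> (\<exists>i<d. generating_vfield \<Phi> (U, \<phi>) x i \<noteq> 0)"
      then have "x \<in> equilibria X \<Phi>" by (intro equilibrium_if_vfield_0[OF U(1)]) auto
      moreover have "x \<in> T"
        using ball x chart_facts(3)[OF U(1)] by (auto dest: inj_onD)
      ultimately show False using T(3) x by blast
    qed
  qed
qed

lemma hopf_index_isolated_equilibrium:
  assumes p: "isolated_equilibrium X \<Phi> p"
  shows "hopf_index d A (generating_vfield \<Phi>) p = 1" "even d"
proof -
  have pE: "p \<in> equilibria X \<Phi>" using p by (simp add: isolated_equilibrium_def)
  obtain U \<phi> r where U: "(U, \<phi>) \<in> A" and r: "0 < r" and pU: "p \<in> U"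
    and ball: "closed_ball d (\<phi> p) r \<subseteq> \<phi> ` U"
    "\<forall>x\<in>U. x \<noteq> p \<and> \<phi> x \<in> closed_ball d (\<phi> p) r \<longrightarrow> (\<exists>i<d. generating_vfield \<Phi> (U, \<phi>) x i \<noteq> 0)"
    using isolated_equilibrium_chart_ball[OF p] .
  note deg = sphere_degree_equilibrium[OF pE U pU r ball]
  then show "even d" by blast
  show "hopf_index d A (generating_vfield \<Phi>) p = 1"
    unfolding hopf_index_def
  proof (rule the_equality)
    show "\<exists>(U, \<phi>)\<in>A. \<exists>r>0. p \<in> U \<and> closed_ball d (\<phi> p) r \<subseteq> \<phi> ` U \<and>
        (\<forall>x\<in>U. x \<noteq> p \<and> \<phi> x \<in> closed_ball d (\<phi> p) r \<longrightarrow> (\<exists>i<d. generating_vfield \<Phi> (U, \<phi>) x i \<noteq> 0)) \<and>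
        1 = sphere_degree d (\<lambda>y. generating_vfield \<Phi> (U, \<phi>) (inv_into U \<phi> y)) (\<phi> p) r"
      using U r pU ball deg by (intro bexI[OF _ U]) auto
  qed (use sphere_degree_equilibrium[OF pE] in auto)
qed

end

theorem proposition1:
  fixes X :: "'a topology"
    and A :: "'a chart set"
    and d :: nat
    and \<Phi> :: "real \<Rightarrow> 'a \<Rightarrow> 'a"
  assumes "C1_manifold d X A"
    and "connected_space X"
    and "compact_space X"
    and "C1_flow d X A \<Phi>"
    and "linearizable_by_C1_embedding d X A \<Phi>"
    and "\<exists>p. isolated_equilibrium X \<Phi> p"
  shows "even d \<and>
    (\<forall>p. isolated_equilibrium X \<Phi> p \<longrightarrow> hopf_index d A (generating_vfield \<Phi>) p = 1)"
proof -
  obtain n F where F: "C1_embedding d X A n (Euclidean_space n) (Euclidean_atlas n) F"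
    and lin: "linearizing X \<Phi> n F"
    using assms(5) by (auto simp: linearizable_by_C1_embedding_def)
  obtain B where B: "B \<in> carrier_mat n n" and FB: "\<And>t x. x \<in> topspace X \<Longrightarrow>
      Matrix.vec n (F (\<Phi> t x)) = mat_exp (t \<cdot>\<^sub>m B) *\<^sub>v Matrix.vec n (F x)"
    using lin by (auto simp: linearizing_def)
  interpret linearized_flow X A d n \<Phi> F "\<lambda>t k j. mat_exp (t \<cdot>\<^sub>m B) $$ (k, j)"
  proof
    fix t x k assume x: "x \<in> topspace X" and k: "k < n"
    have dim: "mat_exp (t \<cdot>\<^sub>m B) \<in> carrier_mat n n" using B by (simp add: mat_exp_def)
    have "F (\<Phi> t x) k = (mat_exp (t \<cdot>\<^sub>m B) *\<^sub>v Matrix.vec n (F x)) $ k"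
      using k by (simp flip: FB[OF x])
    also have "\<dots> = (\<Sum>j<n. mat_exp (t \<cdot>\<^sub>m B) $$ (k, j) * F x j)"
      using dim k by (auto simp: scalar_prod_def atLeast0LessThan intro!: sum.cong)
    finally show "F (\<Phi> t x) k = (\<Sum>j<n. mat_exp (t \<cdot>\<^sub>m B) $$ (k, j) * F x j)" .
  qed (use assms F in auto)
  show ?thesis using hopf_index_isolated_equilibrium assms(6) by blast
qed

end
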